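(* Let $1\le p<\infty$, let $X$ be a pointed metric space, let $E,F$ be Banach spaces and let $T\in LipL_0(X\times E;F)$. The following properties are equivalent. 1) $T$ belongs to $\Pi_{F,St,p}^{LipL}(X\times E;F)$. 2) The linearization $\widehat{T}:X\widehat{\boxtimes}_\pi E\to F$ is $p$-summing. 3) There exist a regular probability measure $\mu$ on $B_{LipL_0(X\times E)}$ and a constant $C>0$ such that for every $m\in\mathbb{N}$, $(x^j)_{j=1}^m,(y^j)_{j=1}^m\subset X$ and $(e^j)_{j=1}^m\subset E$, $$\Big\|\sum_{j=1}^m \big(T(x^j,e^j)-T(y^j,e^j)\big)\Big\|\le C\Big(\int_{B_{LipL_0(X\times E)}}\Big|\sum_{j=1}^m\big(\varphi(x^j,e^j)-\varphi(y^j,e^j)\big)\Big|^p d\mu(\varphi)\Big)^{1/p}.$$ In addition, the correspondence $T\leftrightarrow\widehat{T}$ gives the isometric identification $\Pi_{F,St,p}^{LipL}(X\times E;F)=\Pi_p(X\widehat{\boxtimes}_\pi E;F)$.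
   Context: Banach spaces are real; $B_E$ is the closed unit ball of $E$ and $E^*$ its topological dual. A pointed metric space $X$ has a metric $d$ and a base point $0$. Lip-linear operators: $T:X\times E\to F$ is Lip-linear if $T(x,\cdot)$ is linear for each $x\in X$ and there is $C>0$ with $\|T(x,e)-T(y,e)\|\le C\,d(x,y)\|e\|$ for all $x,y\in X$, $e\in E$. $LipL_0(X\times E;F)$ is the Banach space of Lip-linear operators with $T(0,e)=0$ for all $e\in E$, normed by $LipL(T)$, the infimum of such $C$. Write $LipL_0(X\times E)=LipL_0(X\times E;\mathbb{R})$; its unit ball $B_{LipL_0(X\times E)}$ carries the (compact Hausdorff) topology of pointwise convergence on $X\times E$. Lipschitz tensor product: $Lip_0(X;E^* )$ is the space of Lipschitz maps $f:X\to E^*$ with $f(0)=0$. For $x,y\in X$, $e\in E$, $\delta_{(x,y)}\boxtimes e$ is the functional $f\mapsto\langle f(x)-f(y),e\rangle$ on $Lip_0(X;E^* )$; $X\boxtimes E$ is the linear span of these functionals, with norm $\pi(u)=\inf\{\sum_{i=1}^n d(x_i,y_i)\|e_i\|: u=\sum_{i=1}^n\delta_{(x_i,y_i)}\boxtimes e_i\}$, and $X\widehat{\boxtimes}_\pi E$ is its completion. Each $T\in LipL_0(X\times E;F)$ has a unique bounded linear linearization $\widehat T:X\widehat{\boxtimes}_\pi E\to F$ with $\widehat T(\delta_{(x,y)}\boxtimes e)=T(x,e)-T(y,e)$; $T\mapsto\widehat T$ is an isometric isomorphism of $LipL_0(X\times E;F)$ onto $\mathcal{L}(X\widehat{\boxtimes}_\pi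 E;F)$. $\Pi_{F,St,p}^{LipL}(X\times E;F)$ (factorable strongly $p$-summing operators; the first subscript $F$ stands for "factorable") is the set of $T\in LipL_0(X\times E;F)$ for which there is $C>0$ such that for all $n,m\in\mathbb{N}$, all $x_i^j,y_i^j\in X$, $e_i^j\in E$ ($1\le i\le n$, $1\le j\le m$), $$\Big(\sum_{i=1}^n\Big\|\sum_{j=1}^m \big(T(x_i^j,e_i^j)-T(y_i^j,e_i^j)\big)\Big\|^p\Big)^{1/p}\le C\sup_{\varphi\in B_{LipL_0(X\times E)}}\Big(\sum_{i=1}^n\Big|\sum_{j=1}^m\big(\varphi(x_i^j,e_i^j)-\varphi(y_i^j,e_i^j)\big)\Big|^p\Big)^{1/p};$$ its norm $\pi_{F,St,p}^{LipL}(T)$ is the infimum of such $C$. $\Pi_p(G;F)$ is the space of $p$-summing linear operators $u:G\to F$, i.e. those for which there is $C>0$ with $(\sum_{i=1}^n\|u(g_i)\|^p)^{1/p}\le C\sup_{g^*\in B_{G^*}}(\sum_{i=1}^n|g^*(g_i)|^p)^{1/p}$ for all finite families $(g_i)\subset G$; its norm $\pi_p(u)$ is the infimum of such $C$. *)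

theory Defs
  imports "HOL-Analysis.Analysis" "HOL-Probability.Probability"
begin

section \<open>The completion of a normed space\<close>

text \<open>Classes of Cauchy sequences modulo null sequences, normed by the limit of the norms.\<close>

definition cauchy_rel :: "(nat \<Rightarrow> 'a::real_normed_vector) \<Rightarrow> (nat \<Rightarrow> 'a) \<Rightarrow> bool" where
  "cauchy_rel u v \<longleftrightarrow> Cauchy u \<and> Cauchy v \<and> (\<lambda>n. u n - v n) \<longlonglongrightarrow> 0"

lemma cauchy_rel_refl_iff [simp]: "cauchy_rel u u \<longleftrightarrow> Cauchy u"
  by (simp add: cauchy_rel_def)

lemma cauchy_rel_part_equivp: "part_equivp (cauchy_rel :: (nat \<Rightarrow> 'a::real_normed_vector) \<Rightarrow> _)"
proof (rule part_equivpI)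
  show "\<exists>u :: nat \<Rightarrow> 'a. cauchy_rel u u"
    by (rule exI[of _ "\<lambda>_. 0"]) (simp add: Cauchy_convergent_iff convergent_Cauchy convergent_const)
  show "symp (cauchy_rel :: (nat \<Rightarrow> 'a) \<Rightarrow> _)"
  proof (rule sympI)
    fix u v :: "nat \<Rightarrow> 'a" assume "cauchy_rel u v"
    then show "cauchy_rel v u"
      unfolding cauchy_rel_def using tendsto_minus[of "\<lambda>n. u n - v n" 0 sequentially] by simp
  qed
  show "transp (cauchy_rel :: (nat \<Rightarrow> 'a) \<Rightarrow> _)"
  proof (rule transpI)
    fix u v w :: "nat \<Rightarrow> 'a" assume "cauchy_rel u v" "cauchy_rel v w"
    then show "cauchy_rel u w"
      unfolding cauchy_rel_def
      using tendsto_add[of "\<lambda>n. u n - v n" 0 sequentially "\<lambda>n. v n - w n" 0] by simp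
  qed
qed

quotient_type (overloaded) 'a completion = "nat \<Rightarrow> 'a::real_normed_vector" / partial: cauchy_rel
  by (rule cauchy_rel_part_equivp)

lemma Cauchy_add_seq:
  fixes u v :: "nat \<Rightarrow> 'a::real_normed_vector"
  assumes "Cauchy u" "Cauchy v"
  shows "Cauchy (\<lambda>n. u n + v n)"
proof (rule metric_CauchyI)
  fix e :: real assume "e > 0"
  then obtain M N where M: "\<forall>m\<ge>M. \<forall>n\<ge>M. dist (u m) (u n) < e / 2"
    and N: "\<forall>m\<ge>N. \<forall>n\<ge>N. dist (v m) (v n) < e / 2"
    using assms unfolding Cauchy_def by (meson half_gt_zero)
  have "dist (u m + v m) (u n + v n) < e" if "m \<ge> max M N" "n \<ge> max M N" for m n
  proof -
    have "dist (u m) (u n) < e / 2" "dist (v m) (v n) < e / 2"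
      using M N that by auto
    then show ?thesis
      using dist_triangle_add[of "u m" "v m" "u n" "v n"] by linarith
  qed
  then show "\<exists>M. \<forall>m\<ge>M. \<forall>n\<ge>M. dist (u m + v m) (u n + v n) < e" by blast
qed

lemma Cauchy_scaleR_seq:
  fixes u :: "nat \<Rightarrow> 'a::real_normed_vector"
  assumes "Cauchy u"
  shows "Cauchy (\<lambda>n. a *\<^sub>R u n)"
  using bounded_linear.Cauchy[OF bounded_linear_scaleR_right assms] .

lemma Cauchy_uminus_seq:
  fixes u :: "nat \<Rightarrow> 'a::real_normed_vector"
  assumes "Cauchy u"
  shows "Cauchy (\<lambda>n. - u n)"
  using Cauchy_scaleR_seq[OF assms, of "-1"] by simp

lemma Cauchy_minus_seq:
  fixes u v :: "nat \<Rightarrow> 'a::real_normed_vector"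
  assumes "Cauchy u" "Cauchy v"
  shows "Cauchy (\<lambda>n. u n - v n)"
  using Cauchy_add_seq[OF assms(1) Cauchy_uminus_seq[OF assms(2)]] by simp

lemma Cauchy_const_seq: "Cauchy (\<lambda>_::nat. a::'a::real_normed_vector)"
  by (simp add: Cauchy_def)

lemma Cauchy_norm_limit:
  fixes u :: "nat \<Rightarrow> 'a::real_normed_vector"
  assumes "Cauchy u"
  shows "(\<lambda>n. norm (u n)) \<longlonglongrightarrow> lim (\<lambda>n. norm (u n))"
proof -
  have "Cauchy (\<lambda>n. norm (u n))"
  proof (rule metric_CauchyI)
    fix e :: real assume "e > 0"
    then obtain M where M: "\<forall>m\<ge>M. \<forall>n\<ge>M. norm (u m - u n) < e"
      using assms unfolding Cauchy_def dist_norm by blast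
    have "dist (norm (u m)) (norm (u n)) < e" if "m \<ge> M" "n \<ge> M" for m n
      using M that norm_triangle_ineq3[of "u m" "u n"] unfolding dist_real_def
      by (meson le_less_trans)
    then show "\<exists>M. \<forall>m\<ge>M. \<forall>n\<ge>M. dist (norm (u m)) (norm (u n)) < e" by blast
  qed
  then show ?thesis
    using Cauchy_convergent_iff convergent_LIMSEQ_iff by blast
qed

lemma cauchy_rel_lim_norm:
  assumes "cauchy_rel u v"
  shows "lim (\<lambda>n. norm (u n)) = lim (\<lambda>n. norm (v n))"
proof -
  have u: "Cauchy u" and v: "Cauchy v" and d: "(\<lambda>n. u n - v n) \<longlonglongrightarrow> 0"
    using assms by (auto simp: cauchy_rel_def)
  have "(\<lambda>n. norm (u n) - norm (v n)) \<longlonglongrightarrow> 0"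
    by (rule Lim_null_comparison[OF _ tendsto_norm_zero[OF d]])
       (simp add: norm_triangle_ineq3)
  moreover have "(\<lambda>n. norm (u n) - norm (v n)) \<longlonglongrightarrow> lim (\<lambda>n. norm (u n)) - lim (\<lambda>n. norm (v n))"
    by (intro tendsto_diff Cauchy_norm_limit u v)
  ultimately show ?thesis
    using LIMSEQ_unique by fastforce
qed

instantiation completion :: (real_normed_vector) real_normed_vector
begin

lift_definition zero_completion :: "'a completion" is "\<lambda>_. 0"
  by (simp add: Cauchy_const_seq)

lift_definition plus_completion :: "'a completion \<Rightarrow> 'a completion \<Rightarrow> 'a completion"
  is "\<lambda>u v n. u n + v n"
proof -
  fix u u' v v' :: "nat \<Rightarrow> 'a" assume *: "cauchy_rel u u'" "cauchy_rel v v'"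
  then show "cauchy_rel (\<lambda>n. u n + v n) (\<lambda>n. u' n + v' n)"
    using tendsto_add[of "\<lambda>n. u n - u' n" 0 sequentially "\<lambda>n. v n - v' n" 0]
    by (auto simp: cauchy_rel_def Cauchy_add_seq add_diff_add)
qed

lift_definition minus_completion :: "'a completion \<Rightarrow> 'a completion \<Rightarrow> 'a completion"
  is "\<lambda>u v n. u n - v n"
proof -
  fix u u' v v' :: "nat \<Rightarrow> 'a" assume *: "cauchy_rel u u'" "cauchy_rel v v'"
  then show "cauchy_rel (\<lambda>n. u n - v n) (\<lambda>n. u' n - v' n)"
    using tendsto_diff[of "\<lambda>n. u n - u' n" 0 sequentially "\<lambda>n. v n - v' n" 0]
    by (auto simp: cauchy_rel_def Cauchy_minus_seq algebra_simps)
qed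

lift_definition uminus_completion :: "'a completion \<Rightarrow> 'a completion" is "\<lambda>u n. - u n"
proof -
  fix u u' :: "nat \<Rightarrow> 'a" assume *: "cauchy_rel u u'"
  then show "cauchy_rel (\<lambda>n. - u n) (\<lambda>n. - u' n)"
    using tendsto_minus[of "\<lambda>n. u n - u' n" 0 sequentially]
    by (auto simp: cauchy_rel_def Cauchy_uminus_seq algebra_simps)
qed

lift_definition scaleR_completion :: "real \<Rightarrow> 'a completion \<Rightarrow> 'a completion"
  is "\<lambda>a u n. a *\<^sub>R u n"
proof -
  fix a :: real and u u' :: "nat \<Rightarrow> 'a" assume *: "cauchy_rel u u'"
  then show "cauchy_rel (\<lambda>n. a *\<^sub>R u n) (\<lambda>n. a *\<^sub>R u' n)"
    using tendsto_scaleR[OF tendsto_const, of "\<lambda>n. u n - u' n" 0 sequentially a]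
    by (auto simp: cauchy_rel_def Cauchy_scaleR_seq scaleR_diff_right)
qed

lift_definition norm_completion :: "'a completion \<Rightarrow> real" is "\<lambda>u. lim (\<lambda>n. norm (u n))"
  by (rule cauchy_rel_lim_norm)

definition sgn_completion :: "'a completion \<Rightarrow> 'a completion" where
  "sgn_completion x = inverse (norm x) *\<^sub>R x"

definition dist_completion :: "'a completion \<Rightarrow> 'a completion \<Rightarrow> real" where
  "dist_completion x y = norm (x - y)"

definition uniformity_completion :: "('a completion \<times> 'a completion) filter" where
  "uniformity_completion = (INF e\<in>{0 <..}. principal {(x, y). dist x y < e})"

definition open_completion :: "'a completion set \<Rightarrow> bool" where
  "open_completion S = (\<forall>x\<in>S. \<forall>\<^sub>F (x', y) in uniformity. x' = x \<longrightarrow> y \<in> S)"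

instance
proof
  fix x y z :: "'a completion" and a b :: real
  show "dist x y = norm (x - y)" by (rule dist_completion_def)
  show "sgn x = inverse (norm x) *\<^sub>R x" by (rule sgn_completion_def)
  show "uniformity = (INF e\<in>{0 <..}. principal {(x :: 'a completion, y). dist x y < e})"
    by (rule uniformity_completion_def)
  show "open U = (\<forall>x\<in>U. \<forall>\<^sub>F (x', y) in uniformity. x' = x \<longrightarrow> y \<in> U)" for U :: "'a completion set"
    by (rule open_completion_def)
  have ex: "Cauchy u \<Longrightarrow> Cauchy v \<Longrightarrow> (\<And>n. u n = v n) \<Longrightarrow> cauchy_rel u v" for u v :: "nat \<Rightarrow> 'a"
    by (simp add: cauchy_rel_def)
  note cs = Cauchy_add_seq Cauchy_minus_seq Cauchy_uminus_seq Cauchy_scaleR_seq Cauchy_const_seq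
  show "x + y + z = x + (y + z)"
    by transfer (rule ex, auto intro!: cs simp: algebra_simps)
  show "x + y = y + x"
    by transfer (rule ex, auto intro!: cs simp: algebra_simps)
  show "0 + x = x"
    by transfer (rule ex, auto intro!: cs simp: algebra_simps)
  show "- x + x = 0"
    by transfer (rule ex, auto intro!: cs simp: algebra_simps)
  show "x - y = x + - y"
    by transfer (rule ex, auto intro!: cs simp: algebra_simps)
  show "a *\<^sub>R (x + y) = a *\<^sub>R x + a *\<^sub>R y"
    by transfer (rule ex, auto intro!: cs simp: algebra_simps)
  show "(a + b) *\<^sub>R x = a *\<^sub>R x + b *\<^sub>R x"
    by transfer (rule ex, auto intro!: cs simp: algebra_simps)
  show "a *\<^sub>R b *\<^sub>R x = (a * b) *\<^sub>R x"
    by transfer (rule ex, auto intro!: cs simp: algebra_simps)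
  show "1 *\<^sub>R x = x"
    by transfer (rule ex, auto intro!: cs simp: algebra_simps)
  show "(norm x = 0) = (x = 0)"
  proof transfer
    fix u :: "nat \<Rightarrow> 'a" assume "cauchy_rel u u"
    then have c: "Cauchy u" by simp
    note l = Cauchy_norm_limit[OF c]
    show "(lim (\<lambda>n. norm (u n)) = 0) = cauchy_rel u (\<lambda>_. 0)"
    proof
      assume "lim (\<lambda>n. norm (u n)) = 0"
      then have "u \<longlonglongrightarrow> 0" using l tendsto_norm_zero_iff by fastforce
      then show "cauchy_rel u (\<lambda>_. 0)" using c by (simp add: cauchy_rel_def Cauchy_const_seq)
    next
      assume "cauchy_rel u (\<lambda>_. 0)"
      from cauchy_rel_lim_norm[OF this] show "lim (\<lambda>n. norm (u n)) = 0" by simp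
    qed
  qed
  show "norm (x + y) \<le> norm x + norm y"
  proof transfer
    fix u v :: "nat \<Rightarrow> 'a" assume "cauchy_rel u u" "cauchy_rel v v"
    then have c: "Cauchy u" "Cauchy v" by simp_all
    show "lim (\<lambda>n. norm (u n + v n)) \<le> lim (\<lambda>n. norm (u n)) + lim (\<lambda>n. norm (v n))"
      by (rule LIMSEQ_le[OF Cauchy_norm_limit[OF Cauchy_add_seq[OF c]]
            tendsto_add[OF Cauchy_norm_limit[OF c(1)] Cauchy_norm_limit[OF c(2)]]])
         (auto intro: norm_triangle_ineq)
  qed
  show "norm (a *\<^sub>R x) = \<bar>a\<bar> * norm x"
  proof transfer
    fix a :: real and u :: "nat \<Rightarrow> 'a" assume "cauchy_rel u u"
    then have c: "Cauchy u" by simp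
    have "(\<lambda>n. norm (a *\<^sub>R u n)) \<longlonglongrightarrow> \<bar>a\<bar> * lim (\<lambda>n. norm (u n))"
      using tendsto_mult_left[OF Cauchy_norm_limit[OF c]] by simp
    then show "lim (\<lambda>n. norm (a *\<^sub>R u n)) = \<bar>a\<bar> * lim (\<lambda>n. norm (u n))"
      by (rule limI)
  qed
qed

end

lift_definition to_completion :: "'a::real_normed_vector \<Rightarrow> 'a completion" is "\<lambda>a _. a"
  by (simp add: Cauchy_const_seq)

lemma norm_to_completion: "norm (to_completion a) = norm a"
  by transfer simp

lemma to_completion_add: "to_completion (a + b) = to_completion a + to_completion b"
  by transfer (simp add: Cauchy_const_seq)

lemma to_completion_diff: "to_completion (a - b) = to_completion a - to_completion b"
  by transfer (simp add: Cauchy_const_seq)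

lemma to_completion_scaleR: "to_completion (c *\<^sub>R a) = c *\<^sub>R to_completion a"
  by transfer (simp add: Cauchy_const_seq)

lemma dist_to_completion: "dist (to_completion a) (to_completion b) = dist a b"
  by (simp add: dist_norm norm_to_completion flip: to_completion_diff)

lemma to_completion_LIMSEQ:
  assumes "Cauchy u"
  shows "(\<lambda>k. to_completion (u k)) \<longlonglongrightarrow> abs_completion u"
proof (rule metric_LIMSEQ_I)
  fix e :: real assume e: "e > 0"
  then obtain M where M: "\<forall>m\<ge>M. \<forall>n\<ge>M. norm (u m - u n) < e / 2"
    using assms unfolding Cauchy_def dist_norm by (meson half_gt_zero)
  have "dist (to_completion (u k)) (abs_completion u) < e" if k: "k \<ge> M" for k
  proof -
    have c: "Cauchy (\<lambda>n. u k - u n)"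
      by (intro Cauchy_minus_seq Cauchy_const_seq assms)
    have "norm (to_completion (u k) - abs_completion u) = lim (\<lambda>n. norm (u k - u n))"
      using assms c
      by (simp add: to_completion.abs_eq minus_completion.abs_eq norm_completion.abs_eq Cauchy_const_seq)
    also have "\<dots> \<le> e / 2"
    proof (rule LIMSEQ_le_const2[OF Cauchy_norm_limit[OF c]])
      show "\<exists>N. \<forall>n\<ge>N. norm (u k - u n) \<le> e / 2"
        using M k by (meson less_imp_le)
    qed
    finally show ?thesis using e by (simp add: dist_norm)
  qed
  then show "\<exists>M. \<forall>k\<ge>M. dist (to_completion (u k)) (abs_completion u) < e" by blast
qed

lemma closure_range_to_completion: "closure (range to_completion) = UNIV"
proof -
  have "x \<in> closure (range to_completion)" for x :: "'a completion"
  proof (induct x rule: completion.abs_induct)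
    case (1 u)
    then have "Cauchy u" by simp
    then show ?case
      unfolding closure_sequential by (intro exI[of _ "\<lambda>k. to_completion (u k)"])
        (auto intro: to_completion_LIMSEQ)
  qed
  then show ?thesis by blast
qed

instance completion :: (real_normed_vector) banach
proof
  fix z :: "nat \<Rightarrow> 'a completion" assume z: "Cauchy z"
  have "\<exists>a. dist (to_completion a) (z k) < inverse (real (Suc k))" for k
  proof -
    have "z k \<in> closure (range to_completion)" by (simp add: closure_range_to_completion)
    then show ?thesis
      unfolding closure_approachable by (metis imageE inverse_positive_iff_positive of_nat_0_less_iff zero_less_Suc)
  qed
  then obtain a where a: "\<And>k. dist (to_completion (a k)) (z k) < inverse (real (Suc k))" by metis
  have d: "(\<lambda>k. to_completion (a k) - z k) \<longlonglongrightarrow> 0"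
  proof (rule Lim_null_comparison[OF _ LIMSEQ_inverse_real_of_nat])
    show "\<forall>\<^sub>F k in sequentially. norm (to_completion (a k) - z k) \<le> inverse (real (Suc k))"
      using a by (intro always_eventually) (simp add: dist_norm less_imp_le)
  qed
  have "Cauchy (\<lambda>k. (to_completion (a k) - z k) + z k)"
    by (rule Cauchy_add_seq[OF LIMSEQ_imp_Cauchy[OF d] z])
  then have "Cauchy a"
    by (simp add: Cauchy_def dist_to_completion)
  from tendsto_diff[OF to_completion_LIMSEQ[OF this] d] show "convergent z"
    unfolding convergent_def by auto
qed

section \<open>Pointed metric spaces and the Lipschitz tensor product\<close>

class pointed_metric_space = metric_space +
  fixes basepoint :: 'a

typedef (overloaded) ('x, 'e) lip0 =
  "{f :: 'x::pointed_metric_space \<Rightarrow> ('e::real_normed_vector \<Rightarrow>\<^sub>L real).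
      (\<exists>C. C-lipschitz_on UNIV f) \<and> f basepoint = 0}"
  morphisms lip0_apply Abs_lip0
  by (rule exI[of _ "\<lambda>_. 0"]) (auto intro: lipschitz_on_constant)

definition delta_box ::
  "'x::pointed_metric_space \<Rightarrow> 'x \<Rightarrow> 'e::real_normed_vector \<Rightarrow> ('x, 'e) lip0 \<Rightarrow> real" where
  "delta_box x y e f = blinfun_apply (lip0_apply f x - lip0_apply f y) e"

typedef (overloaded) ('x, 'e) lip_tensor =
  "{u :: ('x::pointed_metric_space, 'e::real_normed_vector) lip0 \<Rightarrow> real.
      \<exists>(n::nat) a x y e. u = (\<lambda>f. \<Sum>i<n. a i * delta_box (x i) (y i) (e i) f)}"
  morphisms tensor_apply Abs_lip_tensor
  by (rule exI[of _ "\<lambda>_. 0"]) (auto intro!: exI[of _ "0::nat"])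

setup_lifting type_definition_lip_tensor

lemma delta_box_scaleR: "delta_box x y (c *\<^sub>R e) f = c * delta_box x y e f"
  by (simp add: delta_box_def blinfun.scaleR_right)

lift_definition tensor_box :: "'x::pointed_metric_space \<Rightarrow> 'x \<Rightarrow> 'e::real_normed_vector \<Rightarrow> ('x, 'e) lip_tensor"
  is delta_box
proof -
  fix x y :: 'x and e :: 'e
  show "\<exists>(n::nat) a x' y' e'. delta_box x y e = (\<lambda>f. \<Sum>i<n. a i * delta_box (x' i) (y' i) (e' i) f)"
    by (rule exI[of _ "1::nat"], rule exI[of _ "\<lambda>_. 1"], rule exI[of _ "\<lambda>_. x"], rule exI[of _ "\<lambda>_. y"], rule exI[of _ "\<lambda>_. e"]) (simp add: fun_eq_iff)
qed

lemma tensor_repr: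
  obtains n :: nat and x y :: "nat \<Rightarrow> 'x::pointed_metric_space" and e :: "nat \<Rightarrow> 'e::real_normed_vector"
  where "tensor_apply u = (\<lambda>f. \<Sum>i<n. delta_box (x i) (y i) (e i) f)"
proof -
  from tensor_apply[of u] obtain n :: nat and a x y and e :: "nat \<Rightarrow> 'e"
    where *: "tensor_apply u = (\<lambda>f. \<Sum>i<n. a i * delta_box (x i) (y i) (e i) f)"
    by auto
  show thesis
    by (rule that[of x y "\<lambda>i. a i *\<^sub>R e i" n]) (simp add: * delta_box_scaleR)
qed

lemma sum_lessThan_append:
  fixes g h :: "nat \<Rightarrow> 'b::comm_monoid_add"
  shows "(\<Sum>i<m+n. if i < m then g i else h (i - m)) = (\<Sum>i<m. g i) + (\<Sum>i<n. h i)"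
proof -
  have "(\<Sum>i<m+n. if i < m then g i else h (i - m))
      = (\<Sum>i<m. if i < m then g i else h (i - m)) + (\<Sum>i=m..<m+n. if i < m then g i else h (i - m))"
    by (metis (no_types, lifting) atLeast0LessThan le0 le_add1 sum.atLeastLessThan_concat)
  moreover have "(\<Sum>i<m. if i < m then g i else h (i - m)) = (\<Sum>i<m. g i)"
    by (rule sum.cong) auto
  moreover have "(\<Sum>i=m..<m+n. if i < m then g i else h (i - m)) = (\<Sum>i<n. h i)"
    by (rule sum.reindex_bij_witness[of _ "\<lambda>i. i + m" "\<lambda>i. i - m"]) auto
  ultimately show ?thesis by simp
qed

instantiation lip_tensor :: (pointed_metric_space, real_normed_vector) real_vector
begin

lift_definition zero_lip_tensor :: "('a, 'b) lip_tensor" is "\<lambda>_. 0"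
  by (auto intro!: exI[of _ "0::nat"])

lift_definition scaleR_lip_tensor :: "real \<Rightarrow> ('a, 'b) lip_tensor \<Rightarrow> ('a, 'b) lip_tensor"
  is "\<lambda>c u f. c * u f"
proof -
  fix c :: real and u :: "('a, 'b) lip0 \<Rightarrow> real"
  assume "\<exists>(n::nat) a x y e. u = (\<lambda>f. \<Sum>i<n. a i * delta_box (x i) (y i) (e i) f)"
  then obtain n :: nat and a x y e where u: "u = (\<lambda>f. \<Sum>i<n. a i * delta_box (x i) (y i) (e i) f)"
    by blast
  show "\<exists>(n::nat) a x y e. (\<lambda>f. c * u f) = (\<lambda>f. \<Sum>i<n. a i * delta_box (x i) (y i) (e i) f)"
    by (intro exI[of _ n] exI[of _ "\<lambda>i. c * a i"] exI[of _ x] exI[of _ y] exI[of _ e])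
       (simp add: u sum_distrib_left mult.assoc)
qed

lift_definition plus_lip_tensor :: "('a, 'b) lip_tensor \<Rightarrow> ('a, 'b) lip_tensor \<Rightarrow> ('a, 'b) lip_tensor"
  is "\<lambda>u v f. u f + v f"
proof -
  fix u v :: "('a, 'b) lip0 \<Rightarrow> real"
  assume "\<exists>(n::nat) a x y e. u = (\<lambda>f. \<Sum>i<n. a i * delta_box (x i) (y i) (e i) f)"
  then obtain n :: nat and a x y e where u: "u = (\<lambda>f. \<Sum>i<n. a i * delta_box (x i) (y i) (e i) f)"
    by blast
  assume "\<exists>(n::nat) a x y e. v = (\<lambda>f. \<Sum>i<n. a i * delta_box (x i) (y i) (e i) f)"
  then obtain m :: nat and a' x' y' e' where v: "v = (\<lambda>f. \<Sum>i<m. a' i * delta_box (x' i) (y' i) (e' i) f)"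
    by blast
  let ?j = "\<lambda>g h i. if i < n then g i else h (i - n)"
  have "u f + v f = (\<Sum>i<n+m. ?j a a' i * delta_box (?j x x' i) (?j y y' i) (?j e e' i) f)" for f
    unfolding u v sum_lessThan_append[symmetric] by (rule sum.cong) auto
  then show "\<exists>(n::nat) a x y e. (\<lambda>f. u f + v f) = (\<lambda>f. \<Sum>i<n. a i * delta_box (x i) (y i) (e i) f)"
    by (intro exI[of _ "n + m"] exI[of _ "?j a a'"] exI[of _ "?j x x'"] exI[of _ "?j y y'"]
          exI[of _ "?j e e'"]) blast
qed

definition uminus_lip_tensor :: "('a, 'b) lip_tensor \<Rightarrow> ('a, 'b) lip_tensor" where
  "uminus_lip_tensor u = (-1) *\<^sub>R u"

definition minus_lip_tensor :: "('a, 'b) lip_tensor \<Rightarrow> ('a, 'b) lip_tensor \<Rightarrow> ('a, 'b) lip_tensor" where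
  "minus_lip_tensor u v = u + (- v)"

instance
  by standard
    (unfold uminus_lip_tensor_def minus_lip_tensor_def, (transfer, simp add: fun_eq_iff algebra_simps)+)

end

lemma tensor_apply_zero [simp]: "tensor_apply 0 f = 0"
  by transfer simp

lemma tensor_apply_add [simp]: "tensor_apply (u + v) f = tensor_apply u f + tensor_apply v f"
  by transfer simp

lemma tensor_apply_scaleR [simp]: "tensor_apply (c *\<^sub>R u) f = c * tensor_apply u f"
  by transfer simp

lemma tensor_apply_sum: "tensor_apply (sum g A) f = (\<Sum>i\<in>A. tensor_apply (g i) f)"
  by (induction A rule: infinite_finite_induct) auto

lemma tensor_apply_box [simp]: "tensor_apply (tensor_box x y e) f = delta_box x y e f"
  by transfer simp

lemma tensor_eqI: "(\<And>f. tensor_apply u f = tensor_apply v f) \<Longrightarrow> u = v"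
  by (metis ext tensor_apply_inject)

lemma tensor_box_scaleR: "tensor_box x y (c *\<^sub>R e) = c *\<^sub>R tensor_box x y e"
  by (rule tensor_eqI) (simp add: delta_box_scaleR)

lemma tensor_repr_sum:
  obtains n :: nat and x y :: "nat \<Rightarrow> 'x::pointed_metric_space" and e :: "nat \<Rightarrow> 'e::real_normed_vector"
  where "u = (\<Sum>i<n. tensor_box (x i) (y i) (e i))"
proof -
  obtain n :: nat and x y and e :: "nat \<Rightarrow> 'e"
    where "tensor_apply u = (\<lambda>f. \<Sum>i<n. delta_box (x i) (y i) (e i) f)"
    by (rule tensor_repr)
  then have "u = (\<Sum>i<n. tensor_box (x i) (y i) (e i))"
    by (intro tensor_eqI) (simp add: tensor_apply_sum)
  then show thesis by (rule that)
qed

definition tensor_costs :: "('x::pointed_metric_space, 'e::real_normed_vector) lip_tensor \<Rightarrow> real set" where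
  "tensor_costs u = {\<Sum>i<n. dist (x i) (y i) * norm (e i) | (n::nat) x y e.
      u = (\<Sum>i<n. tensor_box (x i) (y i) (e i))}"

lemma tensor_costs_nonempty: "tensor_costs u \<noteq> {}"
  by (rule tensor_repr_sum[of u]) (auto simp: tensor_costs_def)

lemma tensor_costs_nonneg: "t \<in> tensor_costs u \<Longrightarrow> 0 \<le> t"
  by (auto simp: tensor_costs_def intro!: sum_nonneg)

lemma tensor_costs_bdd_below: "bdd_below (tensor_costs u)"
  using tensor_costs_nonneg by (rule bdd_belowI)

lemma tensor_costs_add:
  assumes "s \<in> tensor_costs u" "t \<in> tensor_costs v"
  shows "s + t \<in> tensor_costs (u + v)"
proof -
  from assms obtain n :: nat and x y e and m :: nat and x' y' e' where
    s: "s = (\<Sum>i<n. dist (x i) (y i) * norm (e i))"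
    and u: "u = (\<Sum>i<n. tensor_box (x i) (y i) (e i))"
    and t: "t = (\<Sum>i<m. dist (x' i) (y' i) * norm (e' i))"
    and v: "v = (\<Sum>i<m. tensor_box (x' i) (y' i) (e' i))"
    unfolding tensor_costs_def by blast
  let ?j = "\<lambda>g h i. if i < n then g i else h (i - n)"
  have "u + v = (\<Sum>i<n+m. tensor_box (?j x x' i) (?j y y' i) (?j e e' i))"
    unfolding u v sum_lessThan_append[symmetric] by (rule sum.cong) auto
  moreover have "s + t = (\<Sum>i<n+m. dist (?j x x' i) (?j y y' i) * norm (?j e e' i))"
    unfolding s t sum_lessThan_append[symmetric] by (rule sum.cong) auto
  ultimately show ?thesis
    unfolding tensor_costs_def
    by (intro CollectI exI[of _ "n + m"] exI[of _ "?j x x'"] exI[of _ "?j y y'"] exI[of _ "?j e e'"] conjI)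
qed

lemma tensor_costs_scaleR:
  assumes "s \<in> tensor_costs u"
  shows "\<bar>c\<bar> * s \<in> tensor_costs (c *\<^sub>R u)"
proof -
  from assms obtain n :: nat and x y e where
    s: "s = (\<Sum>i<n. dist (x i) (y i) * norm (e i))"
    and u: "u = (\<Sum>i<n. tensor_box (x i) (y i) (e i))"
    unfolding tensor_costs_def by blast
  have "c *\<^sub>R u = (\<Sum>i<n. tensor_box (x i) (y i) (c *\<^sub>R e i))"
    by (simp add: u scaleR_sum_right tensor_box_scaleR)
  moreover have "\<bar>c\<bar> * s = (\<Sum>i<n. dist (x i) (y i) * norm (c *\<^sub>R e i))"
    by (simp add: s sum_distrib_left mult_ac)
  ultimately show ?thesis
    unfolding tensor_costs_def by (intro CollectI exI[of _ n] exI[of _ x] exI[of _ y] exI[of _ "\<lambda>i. c *\<^sub>R e i"]) simp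
qed

lemma tensor_apply_le_cost:
  assumes "s \<in> tensor_costs u" "C-lipschitz_on UNIV (lip0_apply f)"
  shows "\<bar>tensor_apply u f\<bar> \<le> C * s"
proof -
  from assms obtain n :: nat and x y e where
    s: "s = (\<Sum>i<n. dist (x i) (y i) * norm (e i))"
    and u: "u = (\<Sum>i<n. tensor_box (x i) (y i) (e i))"
    unfolding tensor_costs_def by blast
  have "\<bar>delta_box (x i) (y i) (e i) f\<bar> \<le> C * (dist (x i) (y i) * norm (e i))" for i
  proof -
    have "\<bar>delta_box (x i) (y i) (e i) f\<bar> \<le> norm (lip0_apply f (x i) - lip0_apply f (y i)) * norm (e i)"
      unfolding delta_box_def using norm_blinfun[of "lip0_apply f (x i) - lip0_apply f (y i)" "e i"] by simp
    also have "\<dots> \<le> (C * dist (x i) (y i)) * norm (e i)"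
      using lipschitz_onD[OF assms(2), of "x i" "y i"] by (intro mult_right_mono) (auto simp: dist_norm)
    finally show ?thesis by (simp add: mult.assoc)
  qed
  then have "(\<Sum>i<n. \<bar>delta_box (x i) (y i) (e i) f\<bar>) \<le> C * s"
    unfolding s sum_distrib_left by (intro sum_mono)
  then show ?thesis
    using sum_abs[of "\<lambda>i. delta_box (x i) (y i) (e i) f" "{..<n}"]
    unfolding u tensor_apply_sum tensor_apply_box by linarith
qed

instantiation lip_tensor :: (pointed_metric_space, real_normed_vector) real_normed_vector
begin

definition norm_lip_tensor :: "('a, 'b) lip_tensor \<Rightarrow> real" where
  "norm_lip_tensor u = Inf {\<Sum>i<n. dist (x i) (y i) * norm (e i) | (n::nat) x y e.
      u = (\<Sum>i<n. tensor_box (x i) (y i) (e i))}"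

definition sgn_lip_tensor :: "('a, 'b) lip_tensor \<Rightarrow> ('a, 'b) lip_tensor" where
  "sgn_lip_tensor u = inverse (norm u) *\<^sub>R u"

definition dist_lip_tensor :: "('a, 'b) lip_tensor \<Rightarrow> ('a, 'b) lip_tensor \<Rightarrow> real" where
  "dist_lip_tensor u v = norm (u - v)"

definition uniformity_lip_tensor :: "(('a, 'b) lip_tensor \<times> ('a, 'b) lip_tensor) filter" where
  "uniformity_lip_tensor = (INF e\<in>{0 <..}. principal {(u, v). dist u v < e})"

definition open_lip_tensor :: "('a, 'b) lip_tensor set \<Rightarrow> bool" where
  "open_lip_tensor S = (\<forall>u\<in>S. \<forall>\<^sub>F (u', v) in uniformity. u' = u \<longrightarrow> v \<in> S)"

instance
proof
  fix u v :: "('a, 'b) lip_tensor" and c :: real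
  have norm_eq: "norm w = Inf (tensor_costs w)" for w :: "('a, 'b) lip_tensor"
    by (simp only: norm_lip_tensor_def tensor_costs_def)
  show "dist u v = norm (u - v)" by (rule dist_lip_tensor_def)
  show "sgn u = inverse (norm u) *\<^sub>R u" by (rule sgn_lip_tensor_def)
  show "uniformity = (INF e\<in>{0 <..}. principal {(u :: ('a, 'b) lip_tensor, v). dist u v < e})"
    by (rule uniformity_lip_tensor_def)
  show "open S = (\<forall>u\<in>S. \<forall>\<^sub>F (u', v) in uniformity. u' = u \<longrightarrow> v \<in> S)" for S :: "('a, 'b) lip_tensor set"
    by (rule open_lip_tensor_def)
  have nonneg: "0 \<le> norm w" for w :: "('a, 'b) lip_tensor"
    unfolding norm_eq by (rule cInf_greatest[OF tensor_costs_nonempty tensor_costs_nonneg])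
  have le: "norm w \<le> s" if "s \<in> tensor_costs w" for s and w :: "('a, 'b) lip_tensor"
    unfolding norm_eq by (rule cInf_lower[OF that tensor_costs_bdd_below])
  have zero: "norm (0 :: ('a, 'b) lip_tensor) = 0"
  proof -
    have "0 \<in> tensor_costs (0 :: ('a, 'b) lip_tensor)"
      unfolding tensor_costs_def by (auto intro!: exI[of _ "0::nat"])
    from le[OF this] nonneg[of 0] show ?thesis by simp
  qed
  show "(norm u = 0) = (u = 0)"
  proof
    assume n0: "norm u = 0"
    show "u = 0"
    proof (rule tensor_eqI)
      fix f :: "('a, 'b) lip0"
      obtain C where C: "C-lipschitz_on UNIV (lip0_apply f)" using lip0_apply[of f] by auto
      have "\<bar>tensor_apply u f\<bar> \<le> e" if e: "e > 0" for e
      proof -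
        have C0: "0 \<le> C" using lipschitz_on_nonneg[OF C] .
        have "Inf (tensor_costs u) < e / (C + 1)" using n0 norm_eq e C0 by simp
        then obtain s where s: "s \<in> tensor_costs u" "s < e / (C + 1)"
          using cInf_lessD[OF tensor_costs_nonempty] by blast
        have "\<bar>tensor_apply u f\<bar> \<le> C * s" by (rule tensor_apply_le_cost[OF s(1) C])
        also have "\<dots> \<le> (C + 1) * s" using tensor_costs_nonneg[OF s(1)] by (simp add: algebra_simps)
        also have "\<dots> \<le> e" using s(2) C0 by (simp add: field_simps)
        finally show ?thesis .
      qed
      then show "tensor_apply u f = tensor_apply 0 f"
        using field_le_epsilon[of "\<bar>tensor_apply u f\<bar>" 0] by simp
    qed
  qed (simp add: zero)
  show "norm (u + v) \<le> norm u + norm v"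
  proof (rule field_le_epsilon)
    fix e :: real assume e: "e > 0"
    obtain s where s: "s \<in> tensor_costs u" "s < norm u + e / 2"
      using cInf_lessD[OF tensor_costs_nonempty, of u "norm u + e / 2"] e norm_eq by auto
    obtain t where t: "t \<in> tensor_costs v" "t < norm v + e / 2"
      using cInf_lessD[OF tensor_costs_nonempty, of v "norm v + e / 2"] e norm_eq by auto
    show "norm (u + v) \<le> norm u + norm v + e"
      using le[OF tensor_costs_add[OF s(1) t(1)]] s(2) t(2) by simp
  qed
  have scale_le: "norm (c *\<^sub>R w) \<le> \<bar>c\<bar> * norm w" for c and w :: "('a, 'b) lip_tensor"
  proof (cases "c = 0")
    case True
    then show ?thesis by (simp add: zero)
  next
    case False
    have "norm (c *\<^sub>R w) / \<bar>c\<bar> \<le> norm w"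
      unfolding norm_eq[of w]
    proof (rule cInf_greatest[OF tensor_costs_nonempty])
      fix s assume "s \<in> tensor_costs w"
      from le[OF tensor_costs_scaleR[OF this, of c]] False
      show "norm (c *\<^sub>R w) / \<bar>c\<bar> \<le> s" by (simp add: field_simps)
    qed
    then show ?thesis using False by (simp add: field_simps)
  qed
  show "norm (c *\<^sub>R u) = \<bar>c\<bar> * norm u"
  proof (cases "c = 0")
    case True
    then show ?thesis by (simp add: zero)
  next
    case False
    have "norm u \<le> norm (c *\<^sub>R u) / \<bar>c\<bar>"
      using scale_le[of "inverse c" "c *\<^sub>R u"] False by (simp add: field_simps)
    then have "\<bar>c\<bar> * norm u \<le> norm (c *\<^sub>R u)" using False by (simp add: field_simps)
    then show ?thesis using scale_le[of c u] by simp
  qed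
qed

end

text \<open>The projective Lipschitz tensor product is the completion of the normed space
  \<open>('x, 'e) lip_tensor\<close>.\<close>

type_synonym ('x, 'e) proj_tensor = "('x, 'e) lip_tensor completion"

abbreviation proj_box ::
  "'x::pointed_metric_space \<Rightarrow> 'x \<Rightarrow> 'e::real_normed_vector \<Rightarrow> ('x, 'e) proj_tensor" where
  "proj_box x y e \<equiv> to_completion (tensor_box x y e)"

section \<open>Lip-linear operators and their linearization\<close>

definition lip_linear_bound ::
  "('x::metric_space \<times> 'e::real_normed_vector \<Rightarrow> 'f::real_normed_vector) \<Rightarrow> real \<Rightarrow> bool" where
  "lip_linear_bound T C \<longleftrightarrow> (\<forall>x y e. norm (T (x, e) - T (y, e)) \<le> C * dist x y * norm e)"

definition LipL0 ::
  "('x::pointed_metric_space \<times> 'e::real_normed_vector \<Rightarrow> 'f::real_normed_vector) set" where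
  "LipL0 = {T. (\<forall>x. linear (\<lambda>e. T (x, e))) \<and> (\<exists>C>0. lip_linear_bound T C)
               \<and> (\<forall>e. T (basepoint, e) = 0)}"

definition LipL_norm ::
  "('x::pointed_metric_space \<times> 'e::real_normed_vector \<Rightarrow> 'f::real_normed_vector) \<Rightarrow> real" where
  "LipL_norm T = Inf {C. C > 0 \<and> lip_linear_bound T C}"

definition LipL0_ball :: "('x::pointed_metric_space \<times> 'e::real_normed_vector \<Rightarrow> real) set" where
  "LipL0_ball = {\<phi> \<in> LipL0. LipL_norm \<phi> \<le> 1}"

text \<open>The value is unspecified for \<open>T\<close> outside \<open>LipL0\<close>; on \<open>LipL0\<close> with Banach range exactly one
  such map exists.\<close>

definition linearization ::
  "('x::pointed_metric_space \<times> 'e::real_normed_vector \<Rightarrow> 'f::real_normed_vector)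
     \<Rightarrow> ('x, 'e) proj_tensor \<Rightarrow> 'f" where
  "linearization T = (THE A. bounded_linear A \<and>
     (\<forall>x y e. A (proj_box x y e) = T (x, e) - T (y, e)))"

section \<open>Summing operators\<close>

definition summing_bound ::
  "real \<Rightarrow> ('g::real_normed_vector \<Rightarrow> 'f::real_normed_vector) \<Rightarrow> real \<Rightarrow> bool" where
  "summing_bound p u C \<longleftrightarrow>
     (\<forall>(n::nat) (g :: nat \<Rightarrow> 'g).
        (\<Sum>i<n. norm (u (g i)) powr p) powr (1 / p)
          \<le> C * (SUP h \<in> (cball 0 1 :: ('g \<Rightarrow>\<^sub>L real) set).
                    (\<Sum>i<n. \<bar>blinfun_apply h (g i)\<bar> powr p) powr (1 / p)))"

definition summing_ops :: "real \<Rightarrow> ('g::real_normed_vector \<Rightarrow> 'f::real_normed_vector) set" where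
  "summing_ops p = {u. linear u \<and> (\<exists>C>0. summing_bound p u C)}"

definition summing_norm ::
  "real \<Rightarrow> ('g::real_normed_vector \<Rightarrow> 'f::real_normed_vector) \<Rightarrow> real" where
  "summing_norm p u = Inf {C. C > 0 \<and> summing_bound p u C}"

definition factorable_bound ::
  "real \<Rightarrow> ('x::pointed_metric_space \<times> 'e::real_normed_vector \<Rightarrow> 'f::real_normed_vector)
     \<Rightarrow> real \<Rightarrow> bool" where
  "factorable_bound p T C \<longleftrightarrow>
     (\<forall>(n::nat) (m::nat) (x :: nat \<Rightarrow> nat \<Rightarrow> 'x) (y :: nat \<Rightarrow> nat \<Rightarrow> 'x) (e :: nat \<Rightarrow> nat \<Rightarrow> 'e).
        (\<Sum>i<n. norm (\<Sum>j<m. T (x i j, e i j) - T (y i j, e i j)) powr p) powr (1 / p)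
          \<le> C * (SUP \<phi> \<in> LipL0_ball.
                    (\<Sum>i<n. \<bar>\<Sum>j<m. \<phi> (x i j, e i j) - \<phi> (y i j, e i j)\<bar> powr p) powr (1 / p)))"

definition factorable_ops ::
  "real \<Rightarrow> ('x::pointed_metric_space \<times> 'e::real_normed_vector \<Rightarrow> 'f::real_normed_vector) set" where
  "factorable_ops p = {T \<in> LipL0. \<exists>C>0. factorable_bound p T C}"

definition factorable_norm ::
  "real \<Rightarrow> ('x::pointed_metric_space \<times> 'e::real_normed_vector \<Rightarrow> 'f::real_normed_vector) \<Rightarrow> real" where
  "factorable_norm p T = Inf {C. C > 0 \<and> factorable_bound p T C}"

section \<open>Regular Borel probability measures\<close>

text \<open>For a set \<open>B\<close> of functions, \<open>borel\<close> below refers to the product topology on the function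
  type, i.e. the topology of pointwise convergence; \<open>restrict_space borel B\<close> is the Borel
  \<open>\<sigma>\<close>-algebra of the subspace \<open>B\<close>.\<close>

definition regular_prob_on :: "'a::topological_space set \<Rightarrow> 'a measure \<Rightarrow> bool" where
  "regular_prob_on B \<mu> \<longleftrightarrow> prob_space \<mu> \<and> space \<mu> = B \<and> sets \<mu> = sets (restrict_space borel B) \<and>
     (\<forall>A \<in> sets \<mu>.
        emeasure \<mu> A = (SUP K \<in> {K. compact K \<and> K \<subseteq> A}. emeasure \<mu> K) \<and>
        emeasure \<mu> A = (INF U \<in> {B \<inter> U |U. open U \<and> A \<subseteq> U}. emeasure \<mu> U))"

end

theory Submission
  imports Defs
begin

text \<open>
  Everything reduces to one observation: the functionals on the projective tensor product of norm at
  most one are exactly the linearizations of the elements of the unit ball \<open>LipL0_ball\<close>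
  (\<open>dual_ball_eq\<close>). The supremum in the definition of a factorable operator is therefore
  the weak \<open>p\<close>-norm of a finite family in the range of \<open>to_completion\<close>, and a
  constant \<open>C\<close> works for \<open>T\<close> as a factorable operator if and only if it works for the
  linearization of \<open>T\<close> as a \<open>p\<close>-summing operator; passing from the dense range to the
  whole completion costs nothing (\<open>dominated_on_UNIV_iff\<close>). The equality holds constant by
  constant, so the two norms agree as well.

  The linearization exists because two representations of the same tensor give the same
  value. The elements of \<open>lip0\<close> separate tensors only through real-valued Lip-linear
  maps, so for a vector-valued \<open>T\<close> this is tested with functionals on the range; the
  functionals come from the Hahn-Banach theorem.

  The measure comes from Pietsch's argument. A summing inequality says that
  each function \<open>\<phi> \<mapsto> \<Sum>i. \<bar>\<phi>(u i)\<bar> powr p\<close> has supremum over the ball at least the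
  corresponding \<open>\<Sum>i. norm (T (u i)) powr p / C powr p\<close>. These pairs form a convex cone, and
  the Mazur-Orlicz theorem turns the domination by the supremum, which is sublinear, into
  domination by a single positive normalized linear functional. It is applied on the space of all bounded
  functions on the ball, not only the continuous ones. The functional then has a value on every
  indicator, that is, it is a finitely additive probability defined on all subsets; a
  Caratheodory construction makes it into a regular Borel measure that is
  no smaller on compact sets, and slicing a continuous function by its compact superlevel
  sets shows that its integral is no smaller than the value of the functional. This inequality in
  one direction is all that domination asks for, which avoids representing the functional exactly and
  with it Urysohn functions and partitions of unity.
\<close>

section \<open>Linear functionals below a sublinear functional\<close>

definition sublinear :: "('v::real_vector \<Rightarrow> real) \<Rightarrow> bool" where
  "sublinear q \<longleftrightarrow> (\<forall>x y. q (x + y) \<le> q x + q y) \<and> (\<forall>c\<ge>0. \<forall>x. q (c *\<^sub>R x) = c * q x)"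

lemma sublinear_add: "sublinear q \<Longrightarrow> q (x + y) \<le> q x + q y"
  and sublinear_scaleR: "sublinear q \<Longrightarrow> c \<ge> 0 \<Longrightarrow> q (c *\<^sub>R x) = c * q x"
  by (auto simp: sublinear_def)

lemma sublinear_zero: "sublinear q \<Longrightarrow> q 0 = 0"
  using sublinear_scaleR[of q 0 0] by simp

lemma sublinear_lower: "sublinear q \<Longrightarrow> - q (- x) \<le> q x"
  using sublinear_add[of q x "- x"] sublinear_zero[of q] by simp

text \<open>
  The minorant is \<open>r x = (INF (w, b)\<in>P. q (x + w) - b)\<close>. The domination hypothesis keeps the
  infimum finite: \<open>b \<le> q w \<le> q (x + w) + q (- x)\<close>. Because \<open>P\<close> is a convex cone, \<open>r\<close> inherits
  subadditivity and homogeneity from \<open>q\<close>; the competitor \<open>(w, b)\<close> itself gives the bound at \<open>- w\<close>.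
\<close>

lemma sublinear_minorant_on_cone:
  fixes q :: "'v::real_vector \<Rightarrow> real" and P :: "('v \<times> real) set"
  assumes q: "sublinear q" and P: "convex_cone P" and dom: "\<And>w b. (w, b) \<in> P \<Longrightarrow> b \<le> q w"
  obtains r where "sublinear r" "\<And>x. r x \<le> q x" "\<And>w b. (w, b) \<in> P \<Longrightarrow> r (- w) \<le> - b"
proof -
  define g where "g x z = q (x + fst z) - snd z" for x z
  define r where "r x = (INF z\<in>P. g x z)" for x
  have ne: "P \<noteq> {}" and zero: "(0, 0) \<in> P"
    using P convex_cone_contains_0[of P] by (auto simp: convex_cone_def zero_prod_def)
  have add: "z + z' \<in> P" if "z \<in> P" "z' \<in> P" for z z'
    using P that by (simp add: convex_cone_add)
  have scale: "c *\<^sub>R z \<in> P" if "z \<in> P" "c \<ge> 0" for z c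
    using P that by (simp add: convex_cone_scaleR)
  have g_lower: "- q (- x) \<le> g x z" if "z \<in> P" for x z
  proof -
    have "snd z \<le> q (fst z)" using dom[of "fst z" "snd z"] that by simp
    also have "\<dots> \<le> q (x + fst z) + q (- x)"
      using sublinear_add[OF q, of "x + fst z" "- x"] by simp
    finally show ?thesis by (simp add: g_def)
  qed
  have bdd: "bdd_below (g x ` P)" for x
    using g_lower by (intro bdd_belowI2[of _ "- q (- x)"]) auto
  have r_le: "r x \<le> g x z" if "z \<in> P" for x z
    unfolding r_def by (rule cINF_lower[OF bdd that])
  have r_ge: "t \<le> r x" if "\<And>z. z \<in> P \<Longrightarrow> t \<le> g x z" for t x
    unfolding r_def by (rule cINF_greatest[OF ne that])
  have r_add: "r (x + y) \<le> r x + r y" for x y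
  proof -
    have "r (x + y) - g y z' \<le> r x" if z': "z' \<in> P" for z'
    proof (rule r_ge)
      fix z assume z: "z \<in> P"
      have "r (x + y) \<le> g (x + y) (z + z')" by (rule r_le[OF add[OF z z']])
      also have "\<dots> \<le> g x z + g y z'"
        using sublinear_add[OF q, of "x + fst z" "y + fst z'"] by (simp add: g_def algebra_simps)
      finally show "r (x + y) - g y z' \<le> g x z" by simp
    qed
    then have "r (x + y) - r x \<le> r y" by (intro r_ge) (simp add: algebra_simps)
    then show ?thesis by simp
  qed
  have r_scale_le: "r (c *\<^sub>R x) \<le> c * r x" if c: "c > 0" for c x
  proof -
    have "r (c *\<^sub>R x) / c \<le> r x"
    proof (rule r_ge)
      fix z assume z: "z \<in> P"
      have "r (c *\<^sub>R x) \<le> g (c *\<^sub>R x) (c *\<^sub>R z)" by (rule r_le) (use scale[OF z] c in simp)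
      also have "\<dots> = c * g x z"
        using sublinear_scaleR[OF q, of c "x + fst z"] c by (simp add: g_def algebra_simps)
      finally show "r (c *\<^sub>R x) / c \<le> g x z" using c by (simp add: field_simps)
    qed
    then show ?thesis using c by (simp add: field_simps)
  qed
  have r_zero: "r 0 = 0"
  proof (rule antisym)
    show "r 0 \<le> 0" using r_le[OF zero, of 0] sublinear_zero[OF q] by (simp add: g_def)
    show "0 \<le> r 0" by (rule r_ge) (use dom in \<open>auto simp: g_def\<close>)
  qed
  have r_scale: "r (c *\<^sub>R x) = c * r x" if "c \<ge> 0" for c x
  proof (cases "c = 0")
    case False
    then have c: "c > 0" using that by simp
    have "r x \<le> r (c *\<^sub>R x) / c"
      using r_scale_le[of "inverse c" "c *\<^sub>R x"] c by (simp add: field_simps)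
    then have "c * r x \<le> r (c *\<^sub>R x)" using c by (simp add: field_simps)
    then show ?thesis using r_scale_le[OF c, of x] by simp
  qed (simp add: r_zero)
  show thesis
  proof (rule that)
    show "sublinear r" using r_add r_scale by (simp add: sublinear_def)
    show "r x \<le> q x" for x using r_le[OF zero, of x] by (simp add: g_def)
    show "r (- w) \<le> - b" if "(w, b) \<in> P" for w b
      using r_le[OF that, of "- w"] sublinear_zero[OF q] by (simp add: g_def)
  qed
qed

lemma convex_cone_ray:
  fixes z :: "'v::real_vector"
  shows "convex_cone ((\<lambda>t. t *\<^sub>R z) ` {0..})"
  unfolding convex_cone_iff
proof (intro conjI ballI allI impI)
  show "0 \<in> (\<lambda>t. t *\<^sub>R z) ` {0..}" by (intro image_eqI[of _ _ 0]) auto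
  show "x + y \<in> (\<lambda>t. t *\<^sub>R z) ` {0..}"
    if "x \<in> (\<lambda>t. t *\<^sub>R z) ` {0..}" "y \<in> (\<lambda>t. t *\<^sub>R z) ` {0..}" for x y
  proof -
    from that obtain s t where "0 \<le> s" "0 \<le> t" "x = s *\<^sub>R z" "y = t *\<^sub>R z" by auto
    then show ?thesis by (intro image_eqI[of _ _ "s + t"]) (auto simp: scaleR_add_left)
  qed
  show "c *\<^sub>R x \<in> (\<lambda>t. t *\<^sub>R z) ` {0..}"
    if "x \<in> (\<lambda>t. t *\<^sub>R z) ` {0..}" "0 \<le> c" for x c
  proof -
    from that obtain t where "0 \<le> t" "x = t *\<^sub>R z" by auto
    then show ?thesis using that(2) by (intro image_eqI[of _ _ "c * t"]) auto
  qed
qed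

text \<open>
  Applying the previous construction to the ray through \<open>(a, r a)\<close> gives a sublinear functional
  below \<open>r\<close> whose value at \<open>- a\<close> is at most \<open>- r a\<close>. Minimality forces it to be \<open>r\<close>, so \<open>r\<close> is
  odd, and an odd sublinear functional is linear.
\<close>

lemma minimal_sublinear_linear:
  assumes r: "sublinear r" and min: "\<And>s. sublinear s \<Longrightarrow> (\<And>x. s x \<le> r x) \<Longrightarrow> s = r"
  shows "linear r"
proof -
  have neg: "r (- a) = - r a" for a
  proof -
    let ?P = "(\<lambda>t. t *\<^sub>R (a, r a)) ` {0..}"
    have mem: "(a, r a) \<in> ?P" by (intro image_eqI[of _ _ 1]) auto
    have "b \<le> r w" if "(w, b) \<in> ?P" for w b
      using that sublinear_scaleR[OF r] by auto
    then obtain s where s: "sublinear s" "\<And>x. s x \<le> r x"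
      "\<And>w b. (w, b) \<in> ?P \<Longrightarrow> s (- w) \<le> - b"
        using sublinear_minorant_on_cone[OF r convex_cone_ray[of "(a, r a)"]] by metis
    have "r (- a) \<le> - r a" using s(3)[OF mem] min[OF s(1,2)] by simp
    then show ?thesis using sublinear_lower[OF r, of a] by simp
  qed
  have add: "r (x + y) = r x + r y" for x y
    using sublinear_add[OF r, of x y] sublinear_add[OF r, of "x + y" "- y"] neg[of y] by simp
  show ?thesis
  proof (rule linearI)
    show "r (c *\<^sub>R x) = c *\<^sub>R r x" for c x
    proof (cases "c \<ge> 0")
      case False
      then have "r (c *\<^sub>R x) = - r ((- c) *\<^sub>R x)" using neg[of "(- c) *\<^sub>R x"] by simp
      then show ?thesis using sublinear_scaleR[OF r, of "- c" x] False by simp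
    qed (simp add: sublinear_scaleR[OF r])
  qed (rule add)
qed

text \<open>
  The Hahn-Banach theorem, by Zorn's lemma among the sublinear functionals below \<open>q\<close>: the pointwise
  infimum of a chain is again sublinear, being bounded below by \<open>- q (- x)\<close>.
\<close>

lemma exists_linear_below_sublinear:
  fixes q :: "'v::real_vector \<Rightarrow> real"
  assumes q: "sublinear q"
  obtains \<Lambda> where "linear \<Lambda>" "\<And>x. \<Lambda> x \<le> q x"
proof -
  let ?A = "{r. sublinear r \<and> r \<le> q}"
  let ?P = "\<lambda>r s :: 'v \<Rightarrow> real. s \<le> r"
  have "\<exists>m\<in>?A. \<forall>a\<in>?A. ?P m a \<longrightarrow> a = m"
  proof (rule predicate_Zorn)
    show "partial_order_on ?A (relation_of ?P ?A)"
      by (rule partial_order_on_relation_ofI) auto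
    fix C assume C: "C \<in> Chains (relation_of ?P ?A)"
    then have CA: "C \<subseteq> ?A" and chain: "\<And>r s. r \<in> C \<Longrightarrow> s \<in> C \<Longrightarrow> r \<le> s \<or> s \<le> r"
      by (auto simp: Chains_def relation_of_def)
    show "\<exists>u\<in>?A. \<forall>a\<in>C. ?P a u"
    proof (cases "C = {}")
      case True
      then show ?thesis using q by auto
    next
      case False
      define u where "u x = (INF r\<in>C. r x)" for x
      have lower: "- q (- x) \<le> r x" if "r \<in> C" for r x
      proof -
        have "sublinear r" "r (- x) \<le> q (- x)" using that CA by (auto simp: le_fun_def)
        then show ?thesis using sublinear_lower[of r x] by linarith
      qed
      then have bdd: "bdd_below ((\<lambda>r. r x) ` C)" for x
        by (intro bdd_belowI2[of _ "- q (- x)"]) auto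
      have u_le: "u x \<le> r x" if "r \<in> C" for r x
        unfolding u_def by (rule cINF_lower[OF bdd that])
      have u_ge: "t \<le> u x" if "\<And>r. r \<in> C \<Longrightarrow> t \<le> r x" for t x
        unfolding u_def by (rule cINF_greatest[OF False that])
      have "u (x + y) \<le> u x + u y" for x y
      proof -
        have "u (x + y) - s y \<le> u x" if s: "s \<in> C" for s
        proof (rule u_ge)
          fix r assume r: "r \<in> C"
          obtain m where m: "m \<in> C" "m \<le> r" "m \<le> s" using chain[OF r s] r s by auto
          have "u (x + y) \<le> m x + m y"
            using u_le[OF m(1), of "x + y"] sublinear_add[of m x y] m(1) CA by auto
          moreover have "m x \<le> r x" "m y \<le> s y" using m by (auto simp: le_fun_def)
          ultimately show "u (x + y) - s y \<le> r x" by simp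
        qed
        then have "u (x + y) - u x \<le> u y" by (intro u_ge) (simp add: algebra_simps)
        then show ?thesis by simp
      qed
      moreover have "u (c *\<^sub>R x) = c * u x" if c: "c \<ge> 0" for c x
      proof -
        have eq: "(\<lambda>r. r (c *\<^sub>R x)) ` C = (\<lambda>r. c * r x) ` C"
          using CA c by (intro image_cong) (auto simp: sublinear_scaleR)
        show ?thesis
        proof (cases "c = 0")
          case True
          then show ?thesis using eq False by (simp add: u_def)
        next
          case c0: False
          have "c * u x \<le> u (c *\<^sub>R x)"
          proof (rule u_ge)
            fix r assume "r \<in> C"
            then show "c * u x \<le> r (c *\<^sub>R x)"
              using u_le[of r x] CA c mult_left_mono[of "u x" "r x" c] by (auto simp: sublinear_scaleR)
          qed
          moreover have "u (c *\<^sub>R x) / c \<le> u x"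
          proof (rule u_ge)
            fix r assume "r \<in> C"
            then show "u (c *\<^sub>R x) / c \<le> r x"
              using u_le[of r "c *\<^sub>R x"] CA c c0
              by (auto simp: sublinear_scaleR field_simps)
          qed
          ultimately show ?thesis using c c0 by (simp add: field_simps)
        qed
      qed
      ultimately have "sublinear u" by (simp add: sublinear_def)
      moreover have "u \<le> q"
      proof (rule le_funI)
        fix x
        obtain r where "r \<in> C" using False by blast
        then show "u x \<le> q x" using u_le[of r x] CA by (auto simp: le_fun_def intro: order_trans)
      qed
      ultimately show ?thesis using u_le by (intro bexI[of _ u]) (auto simp: le_fun_def)
    qed
  qed
  then obtain m where m: "sublinear m" "m \<le> q"
    and min: "\<And>a. sublinear a \<Longrightarrow> a \<le> q \<Longrightarrow> a \<le> m \<Longrightarrow> a = m" by blast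
  have "linear m"
  proof (rule minimal_sublinear_linear[OF m(1)])
    fix s assume "sublinear s" "\<And>x. s x \<le> m x"
    then show "s = m" using min[of s] m(2) by (auto simp: le_fun_def intro: order_trans)
  qed
  then show thesis using that m(2) by (auto simp: le_fun_def)
qed

text \<open>
  Stated for a cone of pairs, the theorem serves two purposes: a single ray yields norming
  functionals, and the cone of summing inequalities yields the dominating mean.
\<close>

theorem Mazur_Orlicz:
  fixes q :: "'v::real_vector \<Rightarrow> real" and P :: "('v \<times> real) set"
  assumes q: "sublinear q" and P: "convex_cone P" and dom: "\<And>w b. (w, b) \<in> P \<Longrightarrow> b \<le> q w"
  obtains \<Lambda> where "linear \<Lambda>" "\<And>x. \<Lambda> x \<le> q x" "\<And>w b. (w, b) \<in> P \<Longrightarrow> b \<le> \<Lambda> w"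
proof -
  obtain r where r: "sublinear r" "\<And>x. r x \<le> q x" "\<And>w b. (w, b) \<in> P \<Longrightarrow> r (- w) \<le> - b"
    using sublinear_minorant_on_cone[OF assms] by blast
  obtain \<Lambda> where L: "linear \<Lambda>" "\<And>x. \<Lambda> x \<le> r x"
    using exists_linear_below_sublinear[OF r(1)] by blast
  show thesis
  proof (rule that)
    show "\<Lambda> x \<le> q x" for x using L(2) r(2) order_trans by blast
    show "b \<le> \<Lambda> w" if "(w, b) \<in> P" for w b
      using L(2)[of "- w"] r(3)[OF that] linear_neg[OF L(1), of w] by simp
  qed (rule L(1))
qed

corollary norming_functional:
  fixes v :: "'v::real_normed_vector"
  obtains h :: "'v \<Rightarrow> real" where "bounded_linear h" "\<And>x. \<bar>h x\<bar> \<le> norm x" "h v = norm v"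
proof -
  let ?P = "(\<lambda>t. t *\<^sub>R (v, norm v)) ` {0..}"
  have q: "sublinear (norm :: 'v \<Rightarrow> real)" by (simp add: sublinear_def norm_triangle_ineq)
  have mem: "(v, norm v) \<in> ?P" by (intro image_eqI[of _ _ 1]) auto
  have "b \<le> norm w" if "(w, b) \<in> ?P" for w b
    using that by auto
  then obtain h where h: "linear h" "\<And>x. h x \<le> norm x" "\<And>w b. (w, b) \<in> ?P \<Longrightarrow> b \<le> h w"
    using Mazur_Orlicz[OF q convex_cone_ray[of "(v, norm v)"]] by metis
  have abs: "\<bar>h x\<bar> \<le> norm x" for x
    using h(2)[of x] h(2)[of "- x"] linear_neg[OF h(1), of x] by simp
  show thesis
  proof (rule that)
    show "bounded_linear h"
      using h(1) abs by (intro bounded_linear_intro[of h 1]) (auto simp: linear_add linear_scale)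
    show "\<bar>h x\<bar> \<le> norm x" for x by (rule abs)
    show "h v = norm v" using h(2)[of v] h(3)[OF mem] by simp
  qed
qed

section \<open>Regular Borel measures from finitely additive charges\<close>

lemma Hausdorff_compact_imp_closed:
  fixes C :: "'a::topological_space set"
  assumes "Hausdorff_space (euclidean :: 'a topology)" "compact C"
  shows "closed C"
  using compactin_imp_closedin[OF assms(1), of C] assms(2) by simp

text \<open>
  The disjoint compact sets \<open>C - U\<close> and \<open>C - V\<close> have disjoint open neighbourhoods \<open>P\<close> and \<open>Q\<close>;
  removing \<open>P\<close> from \<open>C\<close> leaves a piece inside \<open>U\<close>, removing \<open>Q\<close> a piece inside \<open>V\<close>. This is
  what makes the inner content below subadditive. The Hausdorff property is a hypothesis on the
  topology, so that it can be supplied for a topology of pointwise convergence by the theorem on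
  products of Hausdorff spaces.
\<close>

lemma compact_subset_Un_open_split:
  fixes C :: "'a::topological_space set"
  assumes H: "Hausdorff_space (euclidean :: 'a topology)"
    and C: "compact C" and "open U" "open V" and sub: "C \<subseteq> U \<union> V"
  obtains C1 C2 where "compact C1" "compact C2" "C1 \<subseteq> U" "C2 \<subseteq> V" "C = C1 \<union> C2"
proof -
  have "compact (C - U)" "compact (C - V)"
    using assms by (auto intro: compact_diff)
  moreover have "(C - U) \<inter> (C - V) = {}" using sub by blast
  ultimately obtain P Q where PQ: "open P" "open Q" "C - U \<subseteq> P" "C - V \<subseteq> Q" "P \<inter> Q = {}"
    using Hausdorff_space_compact_separation[OF H, of "C - U" "C - V"]
    by (auto simp: disjnt_def)
  show thesis
  proof (rule that[of "C - P" "C - Q"])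
    show "compact (C - P)" "compact (C - Q)" using C PQ by (auto intro: compact_diff)
  qed (use PQ in blast)+
qed

text \<open>
  Such a charge can have too little mass on compact sets and too much on open ones, so it is
  regularized: from compact subsets to open sets by a supremum, then from open sets to
  all sets by an infimum. Each step restores one half of regularity.
\<close>

locale compact_charge =
  fixes K :: "'a::topological_space set" and m :: "'a set \<Rightarrow> real"
  assumes Hausdorff: "Hausdorff_space (euclidean :: 'a topology)"
    and compact_K: "compact K"
    and nonneg: "A \<subseteq> K \<Longrightarrow> 0 \<le> m A"
    and additive: "A \<subseteq> K \<Longrightarrow> B \<subseteq> K \<Longrightarrow> A \<inter> B = {} \<Longrightarrow> m (A \<union> B) = m A + m B"
    and total: "m K = 1"
begin

definition inner_content :: "'a set \<Rightarrow> ennreal" where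
  "inner_content U = (SUP C\<in>{C. compact C \<and> C \<subseteq> U}. ennreal (m C))"

definition outer_content :: "'a set \<Rightarrow> ennreal" where
  "outer_content A = (INF V\<in>{V. open V \<and> A \<subseteq> V}. inner_content (K \<inter> V))"

lemma m_mono:
  assumes "A \<subseteq> B" "B \<subseteq> K"
  shows "m A \<le> m B"
proof -
  have "B - A \<subseteq> K" "A \<union> (B - A) = B" using assms by auto
  then show ?thesis using additive[of A "B - A"] nonneg[of "B - A"] assms by auto
qed

lemma m_empty: "m {} = 0"
  using additive[of "{}" "{}"] by simp

lemma m_Un_le:
  assumes "A \<subseteq> K" "B \<subseteq> K"
  shows "m (A \<union> B) \<le> m A + m B"
proof -
  have "B - A \<subseteq> K" using assms by auto
  then show ?thesis using additive[of A "B - A"] m_mono[of "B - A" B] assms by auto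
qed

lemma inner_content_mono: "U \<subseteq> V \<Longrightarrow> inner_content U \<le> inner_content V"
  unfolding inner_content_def by (rule SUP_subset_mono) auto

lemma le_inner: "compact C \<Longrightarrow> C \<subseteq> U \<Longrightarrow> ennreal (m C) \<le> inner_content U"
  unfolding inner_content_def by (rule SUP_upper) auto

lemma inner_content_le_1: "U \<subseteq> K \<Longrightarrow> inner_content U \<le> 1"
  unfolding inner_content_def using m_mono[of _ K] total by (intro SUP_least) (simp add: subset_trans[of _ U])

lemma outer_le: "open V \<Longrightarrow> A \<subseteq> V \<Longrightarrow> outer_content A \<le> inner_content (K \<inter> V)"
  unfolding outer_content_def by (rule INF_lower) auto

lemma outer_open: "open V \<Longrightarrow> outer_content (K \<inter> V) = inner_content (K \<inter> V)"
proof (rule antisym)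
  assume V: "open V"
  show "outer_content (K \<inter> V) \<le> inner_content (K \<inter> V)" using V by (rule outer_le) simp
  show "inner_content (K \<inter> V) \<le> outer_content (K \<inter> V)"
    unfolding outer_content_def by (rule INF_greatest, rule inner_content_mono) blast
qed

lemma outer_mono: "A \<subseteq> B \<Longrightarrow> outer_content A \<le> outer_content B"
  unfolding outer_content_def by (rule INF_superset_mono) auto

lemma outer_K: "outer_content K = 1"
proof (rule antisym)
  show "outer_content K \<le> 1" using outer_open[of UNIV] inner_content_le_1[of K] by simp
  show "1 \<le> outer_content K"
    using outer_open[of UNIV] le_inner[OF compact_K, of K] total by simp
qed

lemma outer_empty: "outer_content {} = 0"
proof -
  have "outer_content {} \<le> inner_content {}" using outer_le[of "{}" "{}"] by simp
  also have "inner_content {} = 0" unfolding inner_content_def by (rule antisym[OF SUP_least]) (auto simp: m_empty)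
  finally show ?thesis by simp
qed

lemma m_le_outer:
  assumes "compact C" "C \<subseteq> K"
  shows "ennreal (m C) \<le> outer_content C"
  unfolding outer_content_def by (rule INF_greatest) (use assms in \<open>auto intro!: le_inner\<close>)

text \<open>
  By induction on \<open>n\<close>, splitting off a compact part inside the last open set.
\<close>

lemma inner_content_finite_cover:
  fixes V :: "nat \<Rightarrow> 'a set"
  assumes "\<And>i. open (V i)" "compact C" "C \<subseteq> K" "C \<subseteq> (\<Union>i<n. V i)"
  shows "ennreal (m C) \<le> (\<Sum>i<n. inner_content (K \<inter> V i))"
  using assms(2-)
proof (induction n arbitrary: C)
  case 0
  then show ?case by (simp add: m_empty)
next
  case (Suc n)
  have "C \<subseteq> (\<Union>i<n. V i) \<union> V n" using Suc.prems(3) by (auto simp: lessThan_Suc)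
  then obtain C1 C2 where C: "compact C1" "compact C2" "C1 \<subseteq> (\<Union>i<n. V i)" "C2 \<subseteq> V n" "C = C1 \<union> C2"
    by (rule compact_subset_Un_open_split[OF Hausdorff Suc.prems(1), rotated 2]) (auto intro: assms(1))
  have "ennreal (m C) \<le> ennreal (m C1 + m C2)"
    using m_Un_le[of C1 C2] C Suc.prems by (intro ennreal_leI) auto
  also have "\<dots> = ennreal (m C1) + ennreal (m C2)"
    using nonneg[of C1] nonneg[of C2] C Suc.prems by (intro ennreal_plus) auto
  also have "\<dots> \<le> (\<Sum>i<n. inner_content (K \<inter> V i)) + inner_content (K \<inter> V n)"
    using C Suc.prems by (intro add_mono Suc.IH le_inner) auto
  finally show ?case by simp
qed

text \<open>
  Compactness reduces a countable cover to a finite one: this is the only source of countable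
  subadditivity, since the charge itself is merely finitely additive.
\<close>

lemma inner_content_countable_cover:
  fixes V :: "nat \<Rightarrow> 'a set"
  assumes "\<And>i. open (V i)"
  shows "inner_content (K \<inter> (\<Union>i. V i)) \<le> (\<Sum>i. inner_content (K \<inter> V i))"
  unfolding inner_content_def[of "K \<inter> (\<Union>i. V i)"]
proof (rule SUP_least, safe)
  fix C assume C: "compact C" "C \<subseteq> K \<inter> (\<Union>i. V i)"
  obtain I where I: "finite I" "C \<subseteq> (\<Union>i\<in>I. V i)"
    by (rule compactE_image[OF C(1), of UNIV V]) (use C(2) assms in auto)
  then obtain n where "I \<subseteq> {..<n}" using finite_nat_iff_bounded by blast
  then have "ennreal (m C) \<le> (\<Sum>i<n. inner_content (K \<inter> V i))"
    using I(2) C by (intro inner_content_finite_cover assms) blast+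
  also have "\<dots> \<le> (\<Sum>i. inner_content (K \<inter> V i))"
    by (rule sum_le_suminf) auto
  finally show "ennreal (m C) \<le> (\<Sum>i. inner_content (K \<inter> V i))" .
qed

lemma outer_countably_subadditive: "countably_subadditive (Pow K) outer_content"
  unfolding countably_subadditive_def
proof (intro allI impI)
  fix A :: "nat \<Rightarrow> 'a set"
  assume "range A \<subseteq> Pow K"
  show "outer_content (\<Union>i. A i) \<le> (\<Sum>i. outer_content (A i))"
  proof (rule ennreal_le_epsilon)
    fix e :: real
    assume e: "0 < e" and fin: "(\<Sum>i. outer_content (A i)) < top"
    have "\<exists>V. open V \<and> A i \<subseteq> V \<and> inner_content (K \<inter> V) < outer_content (A i) + e * (1/2) ^ Suc i" for i
    proof -
      have "outer_content (A i) < top" using fin ennreal_suminf_lessD by blast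
      then have "outer_content (A i) < outer_content (A i) + e * (1/2) ^ Suc i"
        using e by (simp add: less_top)
      then show ?thesis unfolding outer_content_def[of "A i"] INF_less_iff by auto
    qed
    then obtain V where V: "\<And>i. open (V i)" "\<And>i. A i \<subseteq> V i"
      "\<And>i. inner_content (K \<inter> V i) < outer_content (A i) + e * (1/2) ^ Suc i" by metis
    have "outer_content (\<Union>i. A i) \<le> inner_content (K \<inter> (\<Union>i. V i))"
      using V by (intro outer_le) auto
    also have "\<dots> \<le> (\<Sum>i. inner_content (K \<inter> V i))" by (rule inner_content_countable_cover[OF V(1)])
    also have "\<dots> \<le> (\<Sum>i. outer_content (A i) + e * (1/2) ^ Suc i)"
      using V(3) by (intro suminf_le) (auto simp: less_imp_le)
    also have "\<dots> = (\<Sum>i. outer_content (A i)) + (\<Sum>i. ennreal (e * (1/2) ^ Suc i))"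
      by (rule suminf_add[symmetric]) auto
    also have "(\<Sum>i. ennreal (e * (1/2) ^ Suc i)) = e"
      using sums_mult[OF power_half_series, of e] e by (intro suminf_ennreal_eq) auto
    finally show "outer_content (\<Union>i. A i) \<le> (\<Sum>i. outer_content (A i)) + e" .
  qed
qed

lemma outer_measure_space_outer: "outer_measure_space (Pow K) outer_content"
  unfolding outer_measure_space_def positive_def increasing_def
  using outer_countably_subadditive outer_empty outer_mono by auto

lemma outer_subadditive:
  assumes "A \<subseteq> K" "B \<subseteq> K" "A \<inter> B = {}"
  shows "outer_content (A \<union> B) \<le> outer_content A + outer_content B"
proof -
  interpret algebra K "Pow K" by (rule algebra_Pow)
  have "subadditive (Pow K) outer_content"
    using countably_subadditive_subadditive outer_measure_space_outer
    by (auto simp: outer_measure_space_def)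
  then show ?thesis using assms by (intro subadditiveD) auto
qed

text \<open>
  Inside an open \<open>W\<close> containing \<open>A\<close>, choose a compact \<open>C\<close> nearly exhausting \<open>W \<inter> V\<close> and then a compact
  \<open>D\<close> nearly exhausting \<open>W - C\<close>, which is open and contains \<open>A - V\<close>. The two are disjoint, so the
  charge of their union is the sum of their charges, and the union is still contained in \<open>W\<close>.
\<close>

lemma open_in_lambda_system:
  assumes "open V"
  shows "K \<inter> V \<in> lambda_system K (Pow K) outer_content"
proof -
  have ne: "{C. compact C \<and> C \<subseteq> U} \<noteq> {}" for U :: "'a set"
    using compact_empty by blast
  have "outer_content (A \<inter> V) + outer_content (A - V) \<le> outer_content A" if A: "A \<subseteq> K" for A
    unfolding outer_content_def[of A]
  proof (rule INF_greatest, safe)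
    fix W assume W: "open W" "A \<subseteq> W"
    have step: "ennreal (m C) + outer_content (A - V) \<le> inner_content (K \<inter> W)"
      if C: "compact C" "C \<subseteq> K \<inter> (W \<inter> V)" for C
    proof -
      have "ennreal (m C) + ennreal (m D) \<le> inner_content (K \<inter> W)"
        if D: "compact D" "D \<subseteq> K \<inter> (W - C)" for D
      proof -
        have "ennreal (m C) + ennreal (m D) = ennreal (m C + m D)"
          using nonneg[of C] nonneg[of D] C D by (intro ennreal_plus[symmetric]) auto
        also have "m C + m D = m (C \<union> D)"
          using C D by (intro additive[symmetric]) auto
        also have "ennreal (m (C \<union> D)) \<le> inner_content (K \<inter> W)"
          using C D by (intro le_inner) auto
        finally show ?thesis .
      qed
      then have "(SUP D\<in>{D. compact D \<and> D \<subseteq> K \<inter> (W - C)}. ennreal (m C) + ennreal (m D))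
          \<le> inner_content (K \<inter> W)"
        by (intro SUP_least) auto
      moreover have "(SUP D\<in>{D. compact D \<and> D \<subseteq> K \<inter> (W - C)}. ennreal (m C) + ennreal (m D))
          = ennreal (m C) + inner_content (K \<inter> (W - C))"
        unfolding inner_content_def by (rule ennreal_SUP_add_right[OF ne, symmetric])
      moreover have "outer_content (A - V) \<le> inner_content (K \<inter> (W - C))"
        using C W by (intro outer_le open_Diff Hausdorff_compact_imp_closed[OF Hausdorff]) auto
      ultimately show ?thesis
        by (metis add_left_mono order_trans)
    qed
    have "outer_content (A \<inter> V) \<le> inner_content (K \<inter> (W \<inter> V))"
      using W assms by (intro outer_le) auto
    then have "outer_content (A \<inter> V) + outer_content (A - V) \<le> inner_content (K \<inter> (W \<inter> V)) + outer_content (A - V)"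
      by (rule add_right_mono)
    also have "\<dots> = (SUP C\<in>{C. compact C \<and> C \<subseteq> K \<inter> (W \<inter> V)}. ennreal (m C) + outer_content (A - V))"
      unfolding inner_content_def by (rule ennreal_SUP_add_left[OF ne, symmetric])
    also have "\<dots> \<le> inner_content (K \<inter> W)" using step by (intro SUP_least) auto
    finally show "outer_content (A \<inter> V) + outer_content (A - V) \<le> inner_content (K \<inter> W)" .
  qed
  moreover have "outer_content A \<le> outer_content (A \<inter> V) + outer_content (A - V)" if "A \<subseteq> K" for A
  proof -
    have "A = (A \<inter> V) \<union> (A - V)" by blast
    then show ?thesis using outer_subadditive[of "A \<inter> V" "A - V"] that by auto
  qed
  moreover have "(K \<inter> V) \<inter> A = A \<inter> V" "(K - K \<inter> V) \<inter> A = A - V" if "A \<subseteq> K" for A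
    using that by auto
  ultimately show ?thesis
    unfolding lambda_system_def by (auto intro!: antisym)
qed

lemma sigma_algebra_restrict_borel: "sigma_algebra K (sets (restrict_space borel K))"
  using sets.sigma_algebra_axioms[of "restrict_space borel K"] by (simp add: space_restrict_space)

lemma measure_space_outer: "measure_space K (sets (restrict_space borel K)) outer_content"
proof -
  let ?L = "lambda_system K (Pow K) outer_content"
  have L: "measure_space K ?L outer_content"
    by (rule sigma_algebra.caratheodory_lemma[OF sigma_algebra_Pow outer_measure_space_outer])
  then interpret L: sigma_algebra K ?L by (simp add: measure_space_def)
  have "K \<inter> A \<in> ?L" if "A \<in> sigma_sets UNIV {S. open S}" for A
    using that
  proof induction
    case (Basic A)
    then show ?case using open_in_lambda_system by auto
  next
    case Empty
    then show ?case by simp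
  next
    case (Compl A)
    then have "K - K \<inter> A \<in> ?L" by auto
    moreover have "K - K \<inter> A = K \<inter> (UNIV - A)" by blast
    ultimately show ?case by simp
  next
    case (Union A)
    then have "(\<Union>i. K \<inter> A i) \<in> ?L" by (intro L.countable_UN) auto
    moreover have "(\<Union>i. K \<inter> A i) = K \<inter> (\<Union>i. A i)" by blast
    ultimately show ?case by simp
  qed
  then have "sets (restrict_space borel K) \<subseteq> ?L"
    by (auto simp: sets_restrict_space borel_def)
  then show ?thesis using measure_down[OF L sigma_algebra_restrict_borel] by blast
qed

definition extension :: "'a measure" where
  "extension = measure_of K (sets (restrict_space borel K)) outer_content"

lemma space_extension: "space extension = K"
  unfolding extension_def
  by (rule sigma_algebra.space_measure_of_eq[OF sigma_algebra_restrict_borel])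

lemma sets_extension: "sets extension = sets (restrict_space borel K)"
  unfolding extension_def
  by (rule sigma_algebra.sets_measure_of_eq[OF sigma_algebra_restrict_borel])

lemma emeasure_extension:
  assumes "A \<in> sets extension"
  shows "emeasure extension A = outer_content A"
  using measure_space_outer assms unfolding sets_extension measure_space_def
  unfolding extension_def by (intro emeasure_measure_of_sigma) auto

lemma prob_space_extension: "prob_space extension"
  by (rule prob_spaceI) (metis emeasure_extension outer_K sets.top space_extension)

lemma Int_open_in_extension: "open V \<Longrightarrow> K \<inter> V \<in> sets extension"
  by (auto simp: sets_extension sets_restrict_space)

lemma compact_in_extension: "compact C \<Longrightarrow> C \<subseteq> K \<Longrightarrow> C \<in> sets extension"
  by (force simp: sets_extension sets_restrict_space intro!: image_eqI[of _ _ C] borel_closed Hausdorff_compact_imp_closed[OF Hausdorff])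

text \<open>
  Outer regularity is built into the outer content. Inner regularity of \<open>A\<close> is outer regularity of
  \<open>K - A\<close>: the complement in \<open>K\<close> of an open set is compact, and the measure is finite.
\<close>

lemma extension_regular: "regular_prob_on K extension"
  unfolding regular_prob_on_def
proof (intro conjI ballI)
  interpret prob_space extension by (rule prob_space_extension)
  fix A assume A: "A \<in> sets extension"
  then have AK: "A \<subseteq> K" using sets.sets_into_space space_extension by blast
  have "emeasure extension A = (INF V\<in>{V. open V \<and> A \<subseteq> V}. emeasure extension (K \<inter> V))"
    unfolding emeasure_extension[OF A] outer_content_def[of A]
    by (intro INF_cong) (auto simp: emeasure_extension Int_open_in_extension outer_open)
  also have "\<dots> = (INF U\<in>(\<lambda>V. K \<inter> V) ` {V. open V \<and> A \<subseteq> V}. emeasure extension U)"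
    by (simp add: image_comp)
  also have "(\<lambda>V. K \<inter> V) ` {V. open V \<and> A \<subseteq> V} = {K \<inter> U |U. open U \<and> A \<subseteq> U}" by blast
  finally show outer_reg:
    "emeasure extension A = (INF U \<in> {K \<inter> U |U. open U \<and> A \<subseteq> U}. emeasure extension U)" .
  show "emeasure extension A = (SUP C \<in> {C. compact C \<and> C \<subseteq> A}. emeasure extension C)"
  proof (rule antisym)
    show "(SUP C \<in> {C. compact C \<and> C \<subseteq> A}. emeasure extension C) \<le> emeasure extension A"
      using A by (intro SUP_least emeasure_mono) auto
    show "emeasure extension A \<le> (SUP C \<in> {C. compact C \<and> C \<subseteq> A}. emeasure extension C)"
    proof (rule ennreal_le_epsilon)
      fix e :: real assume e: "0 < e"
      have KA: "K - A \<in> sets extension" using A sets.compl_sets[of A extension] by (simp add: space_extension)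
      have "outer_content (K - A) < outer_content (K - A) + e"
        using e emeasure_finite[of "K - A"] emeasure_extension[OF KA]
        by (simp add: less_top)
      then obtain V where V: "open V" "K - A \<subseteq> V" "inner_content (K \<inter> V) < outer_content (K - A) + e"
        unfolding outer_content_def[of "K - A"] INF_less_iff by auto
      have "emeasure extension (K \<inter> V) < emeasure extension (K - A) + e"
        using V by (simp add: emeasure_extension KA Int_open_in_extension outer_open)
      then have "prob (K \<inter> V) < prob (K - A) + e"
        using e unfolding emeasure_eq_measure
        by (simp flip: ennreal_plus add: ennreal_less_iff)
      moreover have "prob (K - A) = 1 - prob A" using prob_compl[OF A] by (simp add: space_extension)
      moreover have "prob (K - K \<inter> V) = 1 - prob (K \<inter> V)"
        using prob_compl[OF Int_open_in_extension[OF V(1)]] by (simp add: space_extension)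
      ultimately have "prob A \<le> prob (K - K \<inter> V) + e" by simp
      then have "emeasure extension A \<le> emeasure extension (K - K \<inter> V) + e"
        using e unfolding emeasure_eq_measure by (simp flip: ennreal_plus add: ennreal_le_iff)
      also have "emeasure extension (K - K \<inter> V) \<le> (SUP C \<in> {C. compact C \<and> C \<subseteq> A}. emeasure extension C)"
      proof (rule SUP_upper)
        have "K - K \<inter> V = K - V" by blast
        then show "K - K \<inter> V \<in> {C. compact C \<and> C \<subseteq> A}"
          using V AK compact_diff[OF compact_K V(1)] by auto
      qed
      finally show "emeasure extension A \<le> (SUP C \<in> {C. compact C \<and> C \<subseteq> A}. emeasure extension C) + e"
        by simp
    qed
  qed
qed (simp_all add: prob_space_extension space_extension sets_extension)

text \<open>
  Every open set containing the compact set \<open>C\<close> has inner content at least \<open>m C\<close>. Equality may fail: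
  the charge of a compact set can be smaller than that of each of its neighbourhoods.
\<close>

lemma charge_le_extension: "compact C \<Longrightarrow> C \<subseteq> K \<Longrightarrow> m C \<le> measure extension C"
  using m_le_outer[of C] emeasure_extension[OF compact_in_extension, of C]
    finite_measure.emeasure_eq_measure[OF prob_space.finite_measure[OF prob_space_extension], of C]
  by (metis ennreal_le_iff measure_nonneg)

end

section \<open>Domination by a regular probability measure\<close>

text \<open>
  A convex cone of pairs \<open>(f, b)\<close> with \<open>b\<close> at most the supremum of \<open>f\<close> over \<open>K\<close>. The supremum is expressed
  through its upper bounds \<open>M\<close>.
\<close>

locale dominated_cone =
  fixes K :: "'a set" and P :: "(('a \<Rightarrow> real) \<times> real) set"
  assumes nonempty: "K \<noteq> {}"
    and bounded: "(f, b) \<in> P \<Longrightarrow> bounded (f ` K)"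
    and zero: "(\<lambda>_. 0, 0) \<in> P"
    and add: "(f, b) \<in> P \<Longrightarrow> (g, c) \<in> P \<Longrightarrow> (\<lambda>x. f x + g x, b + c) \<in> P"
    and scale: "(f, b) \<in> P \<Longrightarrow> 0 \<le> t \<Longrightarrow> (\<lambda>x. t * f x, t * b) \<in> P"
    and dominated: "(f, b) \<in> P \<Longrightarrow> (\<And>x. x \<in> K \<Longrightarrow> f x \<le> M) \<Longrightarrow> b \<le> M"

text \<open>
  The Mazur-Orlicz theorem for the functional \<open>SUP x\<in>K. f x\<close>. It needs a real vector space of functions
  that contains the indicators of all sets: the bounded continuous functions on a discrete copy of
  the domain are exactly the bounded functions. Functions bounded only on \<open>K\<close> are extended by zero.
\<close>

lemma (in dominated_cone) dominating_mean:
  obtains \<Lambda> :: "('a \<Rightarrow> real) \<Rightarrow> real" where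
    "\<And>f g. bounded (f ` K) \<Longrightarrow> bounded (g ` K) \<Longrightarrow> \<Lambda> (\<lambda>x. f x + g x) = \<Lambda> f + \<Lambda> g"
    "\<And>f c. bounded (f ` K) \<Longrightarrow> \<Lambda> (\<lambda>x. c * f x) = c * \<Lambda> f"
    "\<And>f M. bounded (f ` K) \<Longrightarrow> (\<And>x. x \<in> K \<Longrightarrow> f x \<le> M) \<Longrightarrow> \<Lambda> f \<le> M"
    "\<And>f b. (f, b) \<in> P \<Longrightarrow> b \<le> \<Lambda> f"
proof -
  define ext :: "('a \<Rightarrow> real) \<Rightarrow> ('a discrete \<Rightarrow>\<^sub>C real)" where
    "ext f = Bcontfun (\<lambda>d. if of_discrete d \<in> K then f (of_discrete d) else 0)" for f
  have ext: "apply_bcontfun (ext f) d = (if of_discrete d \<in> K then f (of_discrete d) else 0)"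
    if "bounded (f ` K)" for f d
  proof -
    from that obtain B where B: "\<And>x. x \<in> K \<Longrightarrow> norm (f x) \<le> B" by (auto simp: bounded_iff)
    have "(\<lambda>d. if of_discrete d \<in> K then f (of_discrete d) else 0) \<in> bcontfun"
      by (rule bcontfun_normI[of _ "max B 0"])
        (use B in \<open>auto simp: continuous_on_open_vimage open_discrete max.coboundedI1\<close>)
    then show ?thesis by (simp add: ext_def Bcontfun_inverse)
  qed
  define q :: "('a discrete \<Rightarrow>\<^sub>C real) \<Rightarrow> real" where "q F = (SUP x\<in>K. apply_bcontfun F (discrete x))" for F
  have bdd: "bdd_above ((\<lambda>x. apply_bcontfun F (discrete x)) ` K)" for F :: "'a discrete \<Rightarrow>\<^sub>C real"
  proof (rule bdd_aboveI2)
    show "apply_bcontfun F (discrete x) \<le> norm F" for x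
      using norm_bounded[of F "discrete x"] by simp
  qed
  have le_q: "apply_bcontfun F (discrete x) \<le> q F" if "x \<in> K" for F x
    unfolding q_def by (rule cSUP_upper[OF that bdd])
  have q_le: "q F \<le> M" if "\<And>x. x \<in> K \<Longrightarrow> apply_bcontfun F (discrete x) \<le> M" for F M
    unfolding q_def by (rule cSUP_least[OF nonempty that])
  have q_add: "q (F + G) \<le> q F + q G" for F G
    by (rule q_le) (simp add: add_mono le_q)
  have q_scale: "q (c *\<^sub>R F) = c * q F" if c: "c \<ge> 0" for c F
  proof (cases "c = 0")
    case True
    then show ?thesis using nonempty by (simp add: q_def)
  next
    case False
    then have c': "c > 0" using c by simp
    have "q (c *\<^sub>R F) \<le> c * q F" by (rule q_le) (simp add: mult_left_mono le_q c)
    moreover have "q F \<le> q (c *\<^sub>R F) / c"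
    proof (rule q_le)
      fix x assume "x \<in> K"
      from le_q[OF this, of "c *\<^sub>R F"] show "apply_bcontfun F (discrete x) \<le> q (c *\<^sub>R F) / c"
        using c' by (simp add: field_simps)
    qed
    ultimately show ?thesis using c' by (simp add: field_simps)
  qed
  have q: "sublinear q" using q_add q_scale by (simp add: sublinear_def)
  have ext_add: "ext (\<lambda>x. f x + g x) = ext f + ext g" if "bounded (f ` K)" "bounded (g ` K)" for f g
    by (rule bcontfun_eqI) (use that bounded_plus_comp[OF that] in \<open>simp add: ext\<close>)
  have bounded_scale: "bounded ((\<lambda>x. c * f x) ` K)" if "bounded (f ` K)" for f :: "'a \<Rightarrow> real" and c
    using bounded_scaling[OF that, of c] by (simp add: image_image)
  have ext_scale: "ext (\<lambda>x. c * f x) = c *\<^sub>R ext f" if "bounded (f ` K)" for f c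
    by (rule bcontfun_eqI) (use that bounded_scale[OF that] in \<open>simp add: ext\<close>)
  let ?P = "(\<lambda>(f, b). (ext f, b)) ` P"
  have P: "convex_cone ?P"
    unfolding convex_cone_iff
  proof (intro conjI ballI allI impI)
    have "ext (\<lambda>_. 0) = 0" by (rule bcontfun_eqI) (subst ext, auto intro: boundedI[of _ 0])
    then show "0 \<in> ?P" using zero by (force simp: zero_prod_def)
    show "z + w \<in> ?P" if "z \<in> ?P" "w \<in> ?P" for z w
    proof -
      from that obtain f b g c where "(f, b) \<in> P" "(g, c) \<in> P" "z = (ext f, b)" "w = (ext g, c)"
        by auto
      then show ?thesis
        using add ext_add[OF bounded bounded] by (intro image_eqI[of _ _ "(\<lambda>x. f x + g x, b + c)"]) auto
    qed
    show "t *\<^sub>R z \<in> ?P" if "z \<in> ?P" "0 \<le> t" for z t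
    proof -
      from that obtain f b where "(f, b) \<in> P" "z = (ext f, b)" by auto
      then show ?thesis
        using scale that(2) ext_scale[OF bounded] by (intro image_eqI[of _ _ "(\<lambda>x. t * f x, t * b)"]) auto
    qed
  qed
  have "b \<le> q w" if "(w, b) \<in> ?P" for w b
  proof -
    from that obtain f where f: "(f, b) \<in> P" "w = ext f" by auto
    show ?thesis
    proof (rule dominated[OF f(1)])
      show "f x \<le> q w" if "x \<in> K" for x
        using le_q[OF that, of w] that f bounded[OF f(1)] by (simp add: ext discrete_inverse)
    qed
  qed
  then obtain \<Lambda> where L: "linear \<Lambda>" "\<And>F. \<Lambda> F \<le> q F" "\<And>w b. (w, b) \<in> ?P \<Longrightarrow> b \<le> \<Lambda> w"
    using Mazur_Orlicz[OF q P] by metis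
  show thesis
  proof (rule that[of "\<lambda>f. \<Lambda> (ext f)"])
    show "\<Lambda> (ext f) \<le> M" if "bounded (f ` K)" "\<And>x. x \<in> K \<Longrightarrow> f x \<le> M" for f M
      by (rule order_trans[OF L(2) q_le]) (use that in \<open>simp add: ext discrete_inverse\<close>)
    show "b \<le> \<Lambda> (ext f)" if "(f, b) \<in> P" for f b
      using that by (intro L(3)) force
    show "\<Lambda> (ext (\<lambda>x. f x + g x)) = \<Lambda> (ext f) + \<Lambda> (ext g)"
      if "bounded (f ` K)" "bounded (g ` K)" for f g
      unfolding ext_add[OF that] by (rule linear_add[OF L(1)])
    show "\<Lambda> (ext (\<lambda>x. c * f x)) = c * \<Lambda> (ext f)" if "bounded (f ` K)" for f c
      using linear_scale[OF L(1), of c "ext f"] unfolding ext_scale[OF that] by simp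
  qed
qed

text \<open>
  The mean is restricted to indicators, which gives a charge, and the charge is made into a regular
  measure. The charge bounds the mean from above on a continuous \<open>f \<ge> 0\<close>: up to an error of
  \<open>e\<close>, \<open>f\<close> is \<open>e\<close> times the sum of the indicators of the sets \<open>S k\<close> on which \<open>f \<ge> (k + 1) * e\<close>.
  These sets are compact, and on compact sets the measure is at least the charge.
\<close>

theorem regular_domination:
  fixes K :: "'a::topological_space set" and P :: "(('a \<Rightarrow> real) \<times> real) set"
  assumes H: "Hausdorff_space (euclidean :: 'a topology)"
    and P: "dominated_cone K P" and K: "compact K"
    and cont: "\<And>f b. (f, b) \<in> P \<Longrightarrow> continuous_on K f"
    and pos: "\<And>f b x. (f, b) \<in> P \<Longrightarrow> x \<in> K \<Longrightarrow> 0 \<le> f x"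
  shows "\<exists>\<mu>. regular_prob_on K \<mu> \<and> (\<forall>(f, b)\<in>P. b \<le> (LINT x|\<mu>. f x))"
proof -
  obtain \<Lambda> :: "('a \<Rightarrow> real) \<Rightarrow> real" where L_add:
    "\<And>f g. bounded (f ` K) \<Longrightarrow> bounded (g ` K) \<Longrightarrow> \<Lambda> (\<lambda>x. f x + g x) = \<Lambda> f + \<Lambda> g"
    and L_scale: "\<And>f c. bounded (f ` K) \<Longrightarrow> \<Lambda> (\<lambda>x. c * f x) = c * \<Lambda> f"
    and L_le: "\<And>f M. bounded (f ` K) \<Longrightarrow> (\<And>x. x \<in> K \<Longrightarrow> f x \<le> M) \<Longrightarrow> \<Lambda> f \<le> M"
    and L_ge: "\<And>f b. (f, b) \<in> P \<Longrightarrow> b \<le> \<Lambda> f"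
    using dominated_cone.dominating_mean[OF P] by blast
  have bs: "bounded ((\<lambda>x. c * f x) ` K)" if "bounded (f ` K)" for f :: "'a \<Rightarrow> real" and c
    using bounded_scaling[OF that, of c] by (simp add: image_image)
  have L_mono: "\<Lambda> f \<le> \<Lambda> g"
    if b: "bounded (f ` K)" "bounded (g ` K)" and le: "\<And>x. x \<in> K \<Longrightarrow> f x \<le> g x" for f g
  proof -
    have "\<Lambda> (\<lambda>x. f x + (- 1) * g x) \<le> 0"
      by (rule L_le) (use bounded_plus_comp[OF b(1) bs[OF b(2), of "-1"]] le in auto)
    then show ?thesis using L_add[OF b(1) bs[OF b(2), of "-1"]] L_scale[OF b(2), of "-1"] by simp
  qed
  define m where "m A = \<Lambda> (indicator A)" for A :: "'a set"
  have bi: "bounded (indicat_real A ` K)" for A :: "'a set"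
    by (rule boundedI[of _ 1]) (auto simp: indicator_def)
  have L_const: "\<Lambda> (\<lambda>_. c) = c" for c
  proof (rule antisym)
    have b: "bounded ((\<lambda>_. d) ` K)" for d :: real by (rule boundedI[of _ "\<bar>d\<bar>"]) auto
    show "\<Lambda> (\<lambda>_. c) \<le> c" by (rule L_le[OF b]) simp
    have "\<Lambda> (\<lambda>_. - c) \<le> - c" by (rule L_le[OF b]) simp
    then show "c \<le> \<Lambda> (\<lambda>_. c)" using L_scale[OF b, of "-1" c] by simp
  qed
  interpret compact_charge K m
  proof
    fix A B :: "'a set" assume AB: "A \<subseteq> K" "B \<subseteq> K" "A \<inter> B = {}"
    have "indicat_real (A \<union> B) = (\<lambda>x. indicator A x + indicator B x)"
      using AB(3) by (intro ext) (auto simp: indicator_def)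
    then show "m (A \<union> B) = m A + m B"
      using L_add[OF bi bi, of A B] by (simp add: m_def)
  next
    fix A :: "'a set"
    have "\<Lambda> (\<lambda>_. 0) \<le> \<Lambda> (indicator A)"
      by (rule L_mono[OF _ bi]) (auto intro!: boundedI[of _ 0])
    then show "0 \<le> m A" by (simp add: m_def L_const)
  next
    have b1: "bounded ((\<lambda>_. 1::real) ` K)" by (rule boundedI[of _ 1]) auto
    have "\<Lambda> (indicator K) = \<Lambda> (\<lambda>_. 1)"
      by (intro antisym L_mono bi b1) auto
    then show "m K = 1" by (simp add: m_def L_const)
  qed (rule H K)+
  interpret prob_space extension by (rule prob_space_extension)
  have L_le_integral: "\<Lambda> f \<le> (LINT x|extension. f x)"
    if f: "continuous_on K f" "\<And>x. x \<in> K \<Longrightarrow> 0 \<le> f x" for f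
  proof (rule field_le_epsilon)
    fix e :: real assume e: "0 < e"
    have bf: "bounded (f ` K)" using compact_imp_bounded[OF compact_continuous_image[OF f(1) K]] .
    then obtain B where B: "\<And>x. x \<in> K \<Longrightarrow> \<bar>f x\<bar> \<le> B" by (auto simp: bounded_iff)
    obtain N :: nat where N: "B < N * e" using reals_Archimedean3[OF e] by metis
    \<comment> \<open>The level \<open>0\<close> is omitted; this keeps the sum below \<open>f\<close> and accounts for the error \<open>e\<close>.\<close>
    define S where "S k = {x \<in> K. (real k + 1) * e \<le> f x}" for k :: nat
    have comp: "compact (S k)" for k
    proof -
      have "closedin (top_of_set K) (S k)"
        using continuous_closedin_preimage[OF f(1), of "{(real k + 1) * e..}"]
        by (simp add: S_def vimage_def Int_def)
      then show ?thesis using K closedin_compact by blast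
    qed
    define s where "s x = (\<Sum>k<N. e * indicator (S k) x)" for x
    \<comment> \<open>On \<open>K\<close>, the sets \<open>S k\<close> containing \<open>x\<close> are those with \<open>k < n x\<close>.\<close>
    define n where "n x = nat \<lfloor>f x / e\<rfloor>" for x
    have s_bounds: "s x \<le> f x" "f x \<le> e + s x" if x: "x \<in> K" for x
    proof -
      have "real (n x) = \<lfloor>f x / e\<rfloor>" using f(2)[OF x] e by (simp add: n_def)
      then have "n x \<le> f x / e" "f x / e < n x + 1" by linarith+
      then have n: "n x * e \<le> f x" "f x < (real (n x) + 1) * e" using e by (simp_all add: field_simps)
      have "n x * e < N * e" using n(1) B[OF x] N by linarith
      then have nN: "n x < N" using e by simp
      have level: "(real k + 1) * e \<le> f x \<longleftrightarrow> k < n x" for k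
      proof
        assume "(real k + 1) * e \<le> f x"
        then have "(real k + 1) * e < (real (n x) + 1) * e" using n(2) by linarith
        then show "k < n x" using e by simp
      next
        assume "k < n x"
        then have "(real k + 1) * e \<le> n x * e" using e by (intro mult_right_mono) auto
        then show "(real k + 1) * e \<le> f x" using n(1) by linarith
      qed
      have "s x = (\<Sum>k<n x. e)"
        unfolding s_def using x nN level
        by (intro sum.mono_neutral_cong_right) (auto simp: S_def)
      then show "s x \<le> f x" "f x \<le> e + s x" using n by (simp_all add: algebra_simps)
    qed
    have bsum: "bounded ((\<lambda>x. \<Sum>k<j. e * indicator (S k) x) ` K)" for j :: nat
    proof (induction j)
      case 0
      show ?case by (rule boundedI[of _ 0]) auto
    next
      case (Suc j)
      then show ?case using bounded_plus_comp[OF Suc bs[OF bi]] by simp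
    qed
    have L_sum: "\<Lambda> (\<lambda>x. \<Sum>k<j. e * indicator (S k) x) = (\<Sum>k<j. e * m (S k))" for j :: nat
    proof (induction j)
      case (Suc j)
      then show ?case using L_add[OF bsum bs[OF bi], of j e "S j"] L_scale[OF bi, of e "S j"]
        by (simp add: m_def)
    qed (simp add: L_const)
    have b_e: "bounded ((\<lambda>_. e) ` K)" by (rule boundedI[of _ "\<bar>e\<bar>"]) auto
    have meas_f: "f \<in> borel_measurable extension"
      using borel_measurable_continuous_on_restrict[OF f(1)] measurable_cong_sets[OF sets_extension refl]
      by blast
    have int_f: "integrable extension f"
      by (rule integrable_const_bound[of _ B]) (use B meas_f in \<open>auto simp: space_extension\<close>)
    have S_sets: "S k \<in> sets extension" for k
      by (rule compact_in_extension[OF comp]) (auto simp: S_def)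
    have "\<Lambda> f \<le> \<Lambda> (\<lambda>x. e + s x)"
      using bounded_plus_comp[OF b_e bsum[of N]] s_bounds by (intro L_mono bf) (auto simp: s_def)
    also have "\<dots> = e + (\<Sum>k<N. e * m (S k))"
      unfolding s_def unfolding L_add[OF b_e bsum[of N]] L_sum L_const by simp
    also have "(\<Sum>k<N. e * m (S k)) \<le> (\<Sum>k<N. e * prob (S k))"
      using e comp by (intro sum_mono mult_left_mono charge_le_extension) (auto simp: S_def)
    also have "\<dots> = (LINT x|extension. s x)"
      unfolding s_def using S_sets by (subst Bochner_Integration.integral_sum) (auto simp: emeasure_eq_measure)
    also have "\<dots> \<le> (LINT x|extension. f x)"
    proof (rule integral_mono[OF _ int_f])
      show "integrable extension s"
        unfolding s_def using S_sets
        by (intro Bochner_Integration.integrable_sum integrable_mult_right)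
          (auto simp: emeasure_eq_measure)
    qed (use s_bounds in \<open>simp add: space_extension\<close>)
    finally show "\<Lambda> f \<le> (LINT x|extension. f x) + e" by simp
  qed
  have "b \<le> (LINT x|extension. f x)" if "(f, b) \<in> P" for f b
    using L_ge[OF that] L_le_integral[OF cont[OF that] pos[OF that]] by simp
  then show ?thesis using extension_regular by blast
qed

section \<open>The unit ball of the scalar Lip-linear maps\<close>

text \<open>
  This shows that the infimum of the admissible constants is itself admissible.
\<close>

lemma le_one_plus_epsilon_mult:
  fixes a b :: real
  assumes "\<And>t. 1 < t \<Longrightarrow> a \<le> t * b" "0 \<le> b"
  shows "a \<le> b"
proof (rule field_le_epsilon)
  fix e :: real assume e: "0 < e"
  have "a \<le> (1 + e / (b + 1)) * b" using assms e by (intro assms(1)) auto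
  also have "\<dots> = b + e * (b / (b + 1))" by (simp add: algebra_simps)
  also have "\<dots> \<le> b + e" using assms(2) e by (simp add: field_simps)
  finally show "a \<le> b + e" .
qed

lemma LipL0_linear: "T \<in> LipL0 \<Longrightarrow> linear (\<lambda>e. T (x, e))"
  and LipL0_basepoint: "T \<in> LipL0 \<Longrightarrow> T (basepoint, e) = 0"
  and LipL0_bound: "T \<in> LipL0 \<Longrightarrow> \<exists>C>0. lip_linear_bound T C"
  by (auto simp: LipL0_def)

text \<open>
  The infimum defining the norm is attained, so membership in the ball is given by conditions on
  finitely many values at a time. These conditions are closed under pointwise convergence.
\<close>

lemma LipL0_ball_iff:
  "\<phi> \<in> LipL0_ball \<longleftrightarrow> (\<forall>x. linear (\<lambda>e. \<phi> (x, e))) \<and> lip_linear_bound \<phi> 1 \<and> (\<forall>e. \<phi> (basepoint, e) = 0)"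
  (is "?l \<longleftrightarrow> ?r")
proof
  assume l: ?l
  then have L: "\<phi> \<in> LipL0" and n: "LipL_norm \<phi> \<le> 1" by (auto simp: LipL0_ball_def)
  have "lip_linear_bound \<phi> 1"
    unfolding lip_linear_bound_def
  proof (intro allI)
    fix x y e
    have "norm (\<phi> (x, e) - \<phi> (y, e)) \<le> dist x y * norm e"
    proof (rule le_one_plus_epsilon_mult)
      fix t :: real assume "1 < t"
      with n have "LipL_norm \<phi> < t" by simp
      then obtain C where C: "C < t" "lip_linear_bound \<phi> C"
        unfolding LipL_norm_def using LipL0_bound[OF L]
        by (subst (asm) cInf_less_iff) (auto intro!: bdd_belowI[of _ 0])
      have "norm (\<phi> (x, e) - \<phi> (y, e)) \<le> C * (dist x y * norm e)"
        using C(2) by (simp add: lip_linear_bound_def mult.assoc)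
      also have "\<dots> \<le> t * (dist x y * norm e)" using C(1) by (intro mult_right_mono) auto
      finally show "norm (\<phi> (x, e) - \<phi> (y, e)) \<le> t * (dist x y * norm e)" .
    qed simp
    then show "norm (\<phi> (x, e) - \<phi> (y, e)) \<le> 1 * dist x y * norm e" by simp
  qed
  then show ?r using L by (auto simp: LipL0_def)
next
  assume r: ?r
  then have "LipL_norm \<phi> \<le> 1"
    unfolding LipL_norm_def by (intro cInf_lower) (auto intro!: bdd_belowI[of _ 0])
  then show ?l using r by (auto simp: LipL0_ball_def LipL0_def intro!: exI[of _ "1::real"])
qed

lemma LipL0_ball_subset: "\<phi> \<in> LipL0_ball \<Longrightarrow> \<phi> \<in> LipL0"
  by (simp add: LipL0_ball_def)

lemma zero_in_LipL0_ball: "(\<lambda>_. 0) \<in> LipL0_ball"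
  by (simp add: LipL0_ball_iff lip_linear_bound_def linear_zero)

text \<open>
  By Tychonoff's theorem: the base point condition confines \<open>\<phi> z\<close> to a compact interval for each
  \<open>z\<close>, and the ball is closed in the product of these intervals.
\<close>

lemma compact_LipL0_ball:
  "compact (LipL0_ball :: ('x::pointed_metric_space \<times> 'e::real_normed_vector \<Rightarrow> real) set)"
proof -
  let ?r = "\<lambda>z :: 'x \<times> 'e. dist (fst z) basepoint * norm (snd z)"
  let ?box = "PiE UNIV (\<lambda>z. {- ?r z..?r z})"
  have "compactin (product_topology (\<lambda>_. euclidean) UNIV) ?box"
    unfolding compactin_PiE by simp
  then have box: "compact ?box" by (simp add: euclidean_product_topology)
  let ?S = "{\<phi> :: 'x \<times> 'e \<Rightarrow> real.
      (\<forall>x e e'. \<phi> (x, e + e') = \<phi> (x, e) + \<phi> (x, e')) \<and> (\<forall>x c e. \<phi> (x, c *\<^sub>R e) = c * \<phi> (x, e)) \<and>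
      (\<forall>x y e. norm (\<phi> (x, e) - \<phi> (y, e)) \<le> dist x y * norm e) \<and> (\<forall>e. \<phi> (basepoint, e) = 0)}"
  have "closed ?S"
    by (intro closed_Collect_conj closed_Collect_all closed_Collect_eq closed_Collect_le
        continuous_intros continuous_on_product_coordinates)
  moreover have "?S = LipL0_ball"
    by (auto simp: LipL0_ball_iff lip_linear_bound_def linear_iff)
  moreover have "LipL0_ball \<subseteq> ?box"
  proof
    fix \<phi> :: "'x \<times> 'e \<Rightarrow> real" assume "\<phi> \<in> LipL0_ball"
    then have "norm (\<phi> (x, e) - \<phi> (basepoint, e)) \<le> 1 * dist x basepoint * norm e" "\<phi> (basepoint, e) = 0"
      for x e unfolding LipL0_ball_iff lip_linear_bound_def by blast+
    then have "\<bar>\<phi> (x, e)\<bar> \<le> dist x basepoint * norm e" for x e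
      by simp
    from abs_le_D1[OF this] abs_le_D2[OF this] show "\<phi> \<in> ?box" by (auto simp: minus_le_iff)
  qed
  ultimately show ?thesis using compact_Int_closed[OF box, of LipL0_ball]
    by (simp add: Int_absorb1)
qed

section \<open>Linearization and the dual of the projective tensor product\<close>

lemma tensor_box_add: "tensor_box x y (e + e') = tensor_box x y e + tensor_box x y e'"
  by (rule tensor_eqI) (simp add: delta_box_def blinfun.add_right)

lemma tensor_box_zero: "tensor_box x y 0 = 0"
  using tensor_box_scaleR[of x y 0 0] by simp

lemma tensor_box_diff: "tensor_box x basepoint e - tensor_box y basepoint e = tensor_box x y e"
proof -
  have "tensor_box x y e + tensor_box y basepoint e = tensor_box x basepoint e"
    by (rule tensor_eqI) (simp add: delta_box_def blinfun.diff_left)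
  then show ?thesis by (metis add_diff_cancel_right')
qed

lemma norm_tensor_box_le: "norm (tensor_box x y e) \<le> dist x y * norm e"
proof -
  have "dist x y * norm e \<in> tensor_costs (tensor_box x y e)"
    unfolding tensor_costs_def
    by (intro CollectI exI[of _ "1::nat"] exI[of _ "\<lambda>_. x"] exI[of _ "\<lambda>_. y"] exI[of _ "\<lambda>_. e"]) simp
  then show ?thesis
    unfolding norm_lip_tensor_def tensor_costs_def[symmetric]
    by (rule cInf_lower[OF _ tensor_costs_bdd_below])
qed

text \<open>
  Real-valued Lip-linear maps are the elements of \<open>lip0\<close>, uncurried: \<open>\<phi>\<close> corresponds to
  \<open>x \<mapsto> \<phi> (x, -)\<close>.
\<close>

lemma LipL0_scalar_lip0:
  fixes \<phi> :: "'x::pointed_metric_space \<times> 'e::real_normed_vector \<Rightarrow> real"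
  assumes "\<phi> \<in> LipL0"
  obtains f where "\<And>x y e. delta_box x y e f = \<phi> (x, e) - \<phi> (y, e)"
proof -
  obtain C where C: "C > 0" "\<And>x y e. \<bar>\<phi> (x, e) - \<phi> (y, e)\<bar> \<le> C * dist x y * norm e"
    using LipL0_bound[OF assms] by (auto simp: lip_linear_bound_def)
  have bl: "bounded_linear (\<lambda>e. \<phi> (x, e))" for x
  proof (rule bounded_linear_intro)
    show "norm (\<phi> (x, e)) \<le> norm e * (C * dist x basepoint)" for e
      using C(2)[of x e basepoint] LipL0_basepoint[OF assms] by (simp add: mult_ac)
  qed (use linear_add[OF LipL0_linear[OF assms]] linear_scale[OF LipL0_linear[OF assms]] in auto)
  define g where "g x = Blinfun (\<lambda>e. \<phi> (x, e))" for x
  have g: "blinfun_apply (g x) e = \<phi> (x, e)" for x e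
    by (simp add: g_def bounded_linear_Blinfun_apply[OF bl])
  have "C-lipschitz_on UNIV g"
  proof (rule lipschitz_onI)
    show "dist (g x) (g y) \<le> C * dist x y" for x y
      unfolding dist_norm[of "g x"]
    proof (rule norm_blinfun_bound)
      show "norm (blinfun_apply (g x - g y) e) \<le> C * dist x y * norm e" for e
        using C(2)[of x e y] by (simp add: blinfun.diff_left g)
    qed (use C(1) in auto)
  qed (use C(1) in auto)
  moreover have "g basepoint = 0"
    by (rule blinfun_eqI) (simp add: g LipL0_basepoint[OF assms])
  ultimately have "lip0_apply (Abs_lip0 g) = g"
    by (intro Abs_lip0_inverse) auto
  then show thesis
    by (intro that[of "Abs_lip0 g"]) (simp add: delta_box_def blinfun.diff_left g)
qed

lemma LipL0_compose_functional:
  assumes "T \<in> LipL0" "bounded_linear h"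
  shows "(\<lambda>z. h (T z)) \<in> LipL0"
proof -
  interpret h: bounded_linear h by fact
  obtain C where C: "C > 0" "\<And>x y e. norm (T (x, e) - T (y, e)) \<le> C * dist x y * norm e"
    using LipL0_bound[OF assms(1)] by (auto simp: lip_linear_bound_def)
  obtain B where B: "B > 0" "\<And>v. norm (h v) \<le> norm v * B" using h.pos_bounded by blast
  have "norm (h (T (x, e)) - h (T (y, e))) \<le> (C * B) * dist x y * norm e" for x y e
  proof -
    have "norm (h (T (x, e) - T (y, e))) \<le> norm (T (x, e) - T (y, e)) * B" by (rule B(2))
    also have "\<dots> \<le> (C * dist x y * norm e) * B" using B(1) C(2) by (intro mult_right_mono) auto
    finally show ?thesis by (simp add: h.diff mult_ac)
  qed
  then have "lip_linear_bound (\<lambda>z. h (T z)) (C * B)" by (simp add: lip_linear_bound_def)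
  moreover have "linear (\<lambda>e. h (T (x, e)))" for x
    using linear_compose[OF LipL0_linear[OF assms(1)] h.linear] by (simp add: o_def)
  ultimately show ?thesis
    using B(1) C(1) LipL0_basepoint[OF assms(1)] by (auto simp: LipL0_def h.zero intro!: exI[of _ "C * B"])
qed

text \<open>
  A norming functional \<open>h\<close> for the difference of the two sums turns \<open>T\<close> into the scalar map
  \<open>h \<circ> T\<close>, on which equal tensors agree by definition.
\<close>

lemma LipL0_sum_eq_of_tensor_eq:
  assumes T: "T \<in> LipL0"
    and eq: "(\<Sum>i<n. tensor_box (x i) (y i) (e i)) = (\<Sum>i<m. tensor_box (x' i) (y' i) (e' i))"
  shows "(\<Sum>i<n::nat. T (x i, e i) - T (y i, e i)) = (\<Sum>i<m::nat. T (x' i, e' i) - T (y' i, e' i))"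
    (is "?v = ?w")
proof -
  obtain h where h: "bounded_linear h" "h (?v - ?w) = norm (?v - ?w)"
    by (rule norming_functional[of "?v - ?w"])
  interpret h: bounded_linear h by fact
  obtain f where f: "\<And>x y e. delta_box x y e f = h (T (x, e)) - h (T (y, e))"
    using LipL0_scalar_lip0[OF LipL0_compose_functional[OF T h(1)]] by blast
  have "h ?v = tensor_apply (\<Sum>i<n. tensor_box (x i) (y i) (e i)) f"
    by (simp add: h.sum h.diff tensor_apply_sum f)
  also have "\<dots> = h ?w"
    unfolding eq by (simp add: h.sum h.diff tensor_apply_sum f)
  finally show ?thesis using h(2) by (simp add: h.diff)
qed

text \<open>
  The bound holds for the cost of every representation, hence for the projective norm, which is the
  infimum of the costs.
\<close>

lemma tensor_lift_exists:
  fixes T :: "'x::pointed_metric_space \<times> 'e::real_normed_vector \<Rightarrow> 'f::real_normed_vector"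
  assumes T: "T \<in> LipL0" and C: "0 \<le> C" "lip_linear_bound T C"
  obtains L where "linear L" "\<And>x y e. L (tensor_box x y e) = T (x, e) - T (y, e)"
    "\<And>u. norm (L u) \<le> C * norm u"
proof -
  have "\<exists>n x y e. u = (\<Sum>i<n::nat. tensor_box (x i) (y i) (e i))" for u :: "('x, 'e) lip_tensor"
    by (rule tensor_repr_sum[of u]) blast
  then obtain n x y e where
    rep: "\<And>u :: ('x, 'e) lip_tensor. u = (\<Sum>i<n u::nat. tensor_box (x u i) (y u i) (e u i))"
    by metis
  define L where "L u = (\<Sum>i<n u. T (x u i, e u i) - T (y u i, e u i))" for u
  have L: "L (\<Sum>i<m. tensor_box (a i) (b i) (c i)) = (\<Sum>i<m. T (a i, c i) - T (b i, c i))" for m :: nat and a b c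
    unfolding L_def by (rule LipL0_sum_eq_of_tensor_eq[OF T], rule rep[symmetric])
  have box: "L (tensor_box a b c) = T (a, c) - T (b, c)" for a b c
    using L[of "\<lambda>_. a" "\<lambda>_. b" "\<lambda>_. c" 1] by simp
  have add: "L (u + v) = L u + L v" for u v
  proof -
    let ?j = "\<lambda>g h i. if i < n u then g i else h (i - n u)"
    have "u + v = (\<Sum>i<n u + n v. tensor_box (?j (x u) (x v) i) (?j (y u) (y v) i) (?j (e u) (e v) i))"
      by (subst rep[of u], subst rep[of v], subst sum_lessThan_append[symmetric])
        (rule sum.cong, auto)
    then have "L (u + v) = (\<Sum>i<n u + n v. T (?j (x u) (x v) i, ?j (e u) (e v) i)
        - T (?j (y u) (y v) i, ?j (e u) (e v) i))"
      using L by metis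
    also have "\<dots> = L u + L v"
      unfolding L_def by (subst sum_lessThan_append[symmetric]) (rule sum.cong, auto)
    finally show ?thesis .
  qed
  have scale: "L (c *\<^sub>R u) = c *\<^sub>R L u" for c u
  proof -
    have "c *\<^sub>R u = (\<Sum>i<n u. tensor_box (x u i) (y u i) (c *\<^sub>R e u i))"
      by (subst rep[of u]) (simp add: scaleR_sum_right tensor_box_scaleR)
    then have "L (c *\<^sub>R u) = (\<Sum>i<n u. T (x u i, c *\<^sub>R e u i) - T (y u i, c *\<^sub>R e u i))"
      using L by metis
    then show ?thesis
      by (simp add: L_def linear_scale[OF LipL0_linear[OF T]] scaleR_sum_right scaleR_diff_right)
  qed
  have norm: "norm (L u) \<le> C * norm u" for u
  proof -
    have cost: "norm (L u) \<le> C * s" if "s \<in> tensor_costs u" for s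
    proof -
      from that obtain m a b c where s: "s = (\<Sum>i<m::nat. dist (a i) (b i) * norm (c i))"
        and u: "u = (\<Sum>i<m. tensor_box (a i) (b i) (c i))"
        unfolding tensor_costs_def by blast
      have "norm (L u) \<le> (\<Sum>i<m. norm (T (a i, c i) - T (b i, c i)))"
        unfolding u L by (rule norm_sum)
      also have "\<dots> \<le> (\<Sum>i<m. C * (dist (a i) (b i) * norm (c i)))"
        using C(2) by (intro sum_mono) (simp add: lip_linear_bound_def mult.assoc)
      finally show ?thesis by (simp add: s sum_distrib_left)
    qed
    show ?thesis
    proof (cases "C = 0")
      case True
      obtain s where "s \<in> tensor_costs u" using tensor_costs_nonempty by blast
      then show ?thesis using cost True by fastforce
    next
      case False
      have "norm (L u) / C \<le> norm u"
        unfolding norm_lip_tensor_def tensor_costs_def[symmetric]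
        by (rule cInf_greatest[OF tensor_costs_nonempty]) (use cost C(1) False in \<open>auto simp: field_simps\<close>)
      then show ?thesis using C(1) False by (simp add: field_simps)
    qed
  qed
  show thesis by (rule that[OF linearI[of L] box norm]) (auto simp: add scale)
qed

lemma to_completion_dense:
  fixes w :: "'a::real_normed_vector completion"
  obtains u where "(\<lambda>n. to_completion (u n)) \<longlonglongrightarrow> w"
proof -
  have "w \<in> closure (range to_completion)" by (simp add: closure_range_to_completion)
  then obtain z where z: "\<And>n. z n \<in> range to_completion" "z \<longlonglongrightarrow> w"
    unfolding closure_sequential by blast
  have "\<forall>n. \<exists>a. z n = to_completion a" using z(1) by auto
  then obtain u where "\<forall>n. z n = to_completion (u n)" by (rule choice[THEN exE])
  then have "z = (\<lambda>n. to_completion (u n))" by auto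
  with z(2) show thesis by (intro that[of u]) simp
qed

lemma bounded_linear_completion_eqI:
  fixes A B :: "'a::real_normed_vector completion \<Rightarrow> 'b::real_normed_vector"
  assumes "bounded_linear A" "bounded_linear B" "\<And>u. A (to_completion u) = B (to_completion u)"
  shows "A = B"
proof
  fix w :: "'a completion"
  obtain u where u: "(\<lambda>n. to_completion (u n)) \<longlonglongrightarrow> w" by (rule to_completion_dense)
  have "(\<lambda>n. A (to_completion (u n))) \<longlonglongrightarrow> A w" "(\<lambda>n. A (to_completion (u n))) \<longlonglongrightarrow> B w"
    using bounded_linear.tendsto[OF assms(1) u] bounded_linear.tendsto[OF assms(2) u] assms(3) by simp_all
  then show "A w = B w" by (rule LIMSEQ_unique)
qed

text \<open>
  The extension is the limit along a representing Cauchy sequence; \<open>A\<close> below records that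
  every sequence with the same limit gives the same value, from which linearity and the bound
  follow by passing to limits.
\<close>

lemma bounded_linear_completion_extension:
  fixes L :: "'a::real_normed_vector \<Rightarrow> 'b::banach"
  assumes L: "linear L" and C: "\<And>u. norm (L u) \<le> C * norm u"
  obtains A where "bounded_linear A" "\<And>u. A (to_completion u) = L u" "\<And>w. norm (A w) \<le> C * norm w"
proof -
  interpret linear L by fact
  have bl: "bounded_linear L" by (rule bounded_linear_intro[of L C]) (auto simp: add scale C mult.commute)
  define A where "A w = lim (\<lambda>n. L (rep_completion w n))" for w
  have A: "(\<lambda>n. L (u n)) \<longlonglongrightarrow> A w" if u: "(\<lambda>n. to_completion (u n)) \<longlonglongrightarrow> w" for u w
  proof -
    let ?r = "rep_completion w"
    have r: "Cauchy ?r" "abs_completion ?r = w"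
      using Quotient_completion Quotient_rep_reflp[OF Quotient_completion, of w]
        Quotient_abs_rep[OF Quotient_completion, of w] by simp_all
    have "convergent (\<lambda>n. L (?r n))"
      using bounded_linear.Cauchy[OF bl r(1)] by (simp add: Cauchy_convergent_iff)
    then have lim_r: "(\<lambda>n. L (?r n)) \<longlonglongrightarrow> A w" by (simp add: A_def convergent_LIMSEQ_iff)
    have "(\<lambda>n. to_completion (?r n)) \<longlonglongrightarrow> w" using to_completion_LIMSEQ[OF r(1)] r(2) by simp
    from tendsto_diff[OF u this] have "(\<lambda>n. to_completion (u n - ?r n)) \<longlonglongrightarrow> 0"
      by (simp add: to_completion_diff)
    then have "(\<lambda>n. norm (to_completion (u n - ?r n))) \<longlonglongrightarrow> 0" by (rule tendsto_norm_zero)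
    then have "(\<lambda>n. u n - ?r n) \<longlonglongrightarrow> 0" by (simp add: norm_to_completion tendsto_norm_zero_iff)
    from bounded_linear.tendsto[OF bl this] have "(\<lambda>n. L (u n) - L (?r n)) \<longlonglongrightarrow> 0"
      by (simp add: diff zero)
    from tendsto_add[OF this lim_r] show ?thesis by simp
  qed
  have ext: "A (to_completion u) = L u" for u
    by (rule LIMSEQ_unique[OF A[OF tendsto_const] tendsto_const])
  have A_add: "A (v + w) = A v + A w" for v w
  proof -
    obtain s where s: "(\<lambda>n. to_completion (s n)) \<longlonglongrightarrow> v" by (rule to_completion_dense)
    obtain t where t: "(\<lambda>n. to_completion (t n)) \<longlonglongrightarrow> w" by (rule to_completion_dense)
    have "(\<lambda>n. to_completion (s n + t n)) \<longlonglongrightarrow> v + w"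
      using tendsto_add[OF s t] by (simp add: to_completion_add)
    from A[OF this] have "(\<lambda>n. L (s n) + L (t n)) \<longlonglongrightarrow> A (v + w)" by (simp add: add)
    then show ?thesis using tendsto_add[OF A[OF s] A[OF t]] LIMSEQ_unique by blast
  qed
  have A_scale: "A (c *\<^sub>R w) = c *\<^sub>R A w" for c w
  proof -
    obtain t where t: "(\<lambda>n. to_completion (t n)) \<longlonglongrightarrow> w" by (rule to_completion_dense)
    have "(\<lambda>n. to_completion (c *\<^sub>R t n)) \<longlonglongrightarrow> c *\<^sub>R w"
      using tendsto_scaleR[OF tendsto_const t] by (simp add: to_completion_scaleR)
    from A[OF this] have "(\<lambda>n. c *\<^sub>R L (t n)) \<longlonglongrightarrow> A (c *\<^sub>R w)" by (simp add: scale)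
    then show ?thesis using tendsto_scaleR[OF tendsto_const A[OF t]] LIMSEQ_unique by blast
  qed
  have A_norm: "norm (A w) \<le> C * norm w" for w
  proof -
    obtain t where t: "(\<lambda>n. to_completion (t n)) \<longlonglongrightarrow> w" by (rule to_completion_dense)
    show ?thesis
    proof (rule LIMSEQ_le[OF tendsto_norm[OF A[OF t]] tendsto_mult[OF tendsto_const tendsto_norm[OF t]]])
      show "\<exists>N. \<forall>n\<ge>N. norm (L (t n)) \<le> C * norm (to_completion (t n))"
        using C by (simp add: norm_to_completion)
    qed
  qed
  show thesis
  proof (rule that[OF _ ext A_norm])
    show "bounded_linear A"
      by (rule bounded_linear_intro[of A C]) (auto simp: A_add A_scale A_norm mult.commute)
  qed
qed

lemma to_completion_zero: "to_completion 0 = 0"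
  using to_completion_scaleR[of 0 0] by simp

lemma to_completion_sum: "to_completion (\<Sum>i\<in>I. u i) = (\<Sum>i\<in>I. to_completion (u i))"
  by (induction I rule: infinite_finite_induct) (auto simp: to_completion_add to_completion_zero)

lemma proj_tensor_eqI:
  fixes A B :: "('x::pointed_metric_space, 'e::real_normed_vector) proj_tensor \<Rightarrow> 'f::real_normed_vector"
  assumes A: "bounded_linear A" and B: "bounded_linear B"
    and eq: "\<And>x y e. A (proj_box x y e) = B (proj_box x y e)"
  shows "A = B"
proof (rule bounded_linear_completion_eqI[OF A B])
  fix u :: "('x, 'e) lip_tensor"
  obtain n x y e where u: "u = (\<Sum>i<n::nat. tensor_box (x i) (y i) (e i))" by (rule tensor_repr_sum)
  show "A (to_completion u) = B (to_completion u)"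
    unfolding u to_completion_sum
    by (simp add: linear_sum[OF bounded_linear.linear[OF A]] linear_sum[OF bounded_linear.linear[OF B]] eq)
qed

lemma linearization_eqI:
  assumes "bounded_linear A" "\<And>x y e. A (proj_box x y e) = T (x, e) - T (y, e)"
  shows "linearization T = A"
  unfolding linearization_def
  by (rule the_equality) (use assms in \<open>auto intro!: proj_tensor_eqI\<close>)

lemma
  fixes T :: "'x::pointed_metric_space \<times> 'e::real_normed_vector \<Rightarrow> 'f::banach"
  assumes T: "T \<in> LipL0"
  shows bounded_linear_linearization: "bounded_linear (linearization T)"
    and linearization_box: "linearization T (proj_box x y e) = T (x, e) - T (y, e)"
    and norm_linearization_le: "0 \<le> C \<Longrightarrow> lip_linear_bound T C \<Longrightarrow> norm (linearization T w) \<le> C * norm w"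
proof -
  have ex: "bounded_linear (linearization T) \<and> (\<forall>x y e. linearization T (proj_box x y e) = T (x, e) - T (y, e))
      \<and> (\<forall>w. norm (linearization T w) \<le> C * norm w)"
    if C: "0 \<le> C" "lip_linear_bound T C" for C
  proof -
    obtain L where L: "linear L" "\<And>x y e. L (tensor_box x y e) = T (x, e) - T (y, e)"
      "\<And>u. norm (L u) \<le> C * norm u"
      using tensor_lift_exists[OF T C] by blast
    obtain A where A: "bounded_linear A" "\<And>u. A (to_completion u) = L u" "\<And>w. norm (A w) \<le> C * norm w"
      using bounded_linear_completion_extension[OF L(1,3)] by blast
    have "linearization T = A" by (rule linearization_eqI) (simp_all add: A L)
    then show ?thesis using A L by simp
  qed
  obtain B where "B > 0" "lip_linear_bound T B" using LipL0_bound[OF T] by blast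
  then show "bounded_linear (linearization T)" "linearization T (proj_box x y e) = T (x, e) - T (y, e)"
    using ex[of B] by auto
  show "0 \<le> C \<Longrightarrow> lip_linear_bound T C \<Longrightarrow> norm (linearization T w) \<le> C * norm w" using ex by blast
qed

lemma linearization_sum:
  fixes T :: "'x::pointed_metric_space \<times> 'e::real_normed_vector \<Rightarrow> 'f::banach"
  assumes T: "T \<in> LipL0"
  shows "linearization T (to_completion (\<Sum>i\<in>I. tensor_box (x i) (y i) (e i)))
    = (\<Sum>i\<in>I. T (x i, e i) - T (y i, e i))"
  by (simp add: to_completion_sum linearization_box[OF T]
      linear_sum[OF bounded_linear.linear[OF bounded_linear_linearization[OF T]]])

text \<open>
  The inverse of linearization: a bounded operator on the tensor product is restricted to the
  elementary tensors with second point the base point.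
\<close>

lemma LipL0_of_bounded_linear:
  fixes A :: "('x::pointed_metric_space, 'e::real_normed_vector) proj_tensor \<Rightarrow> 'f::banach"
  assumes A: "bounded_linear A"
  defines "T \<equiv> \<lambda>(x, e). A (proj_box x basepoint e)"
  shows "T \<in> LipL0" "linearization T = A"
    "(\<And>w. norm (A w) \<le> C * norm w) \<Longrightarrow> 0 \<le> C \<Longrightarrow> lip_linear_bound T C"
proof -
  interpret A: bounded_linear A by fact
  have diff: "T (x, e) - T (y, e) = A (proj_box x y e)" for x y e
    by (simp add: T_def flip: A.diff to_completion_diff tensor_box_diff[of x e y])
  show bound: "lip_linear_bound T C" if C: "\<And>w. norm (A w) \<le> C * norm w" "0 \<le> C" for C
    unfolding lip_linear_bound_def diff
  proof (intro allI)
    fix x y e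
    have "norm (A (proj_box x y e)) \<le> C * norm (proj_box x y e)" by (rule C(1))
    also have "\<dots> \<le> C * (dist x y * norm e)"
      using C(2) by (intro mult_left_mono) (simp_all add: norm_to_completion norm_tensor_box_le)
    finally show "norm (A (proj_box x y e)) \<le> C * dist x y * norm e" by (simp add: mult.assoc)
  qed
  obtain C where C: "C > 0" "\<And>w. norm (A w) \<le> norm w * C" using A.pos_bounded by blast
  have "lip_linear_bound T C" using C by (intro bound) (simp_all add: mult.commute)
  moreover have "linear (\<lambda>e. T (x, e))" for x
    by (rule linearI) (simp_all add: T_def tensor_box_add tensor_box_scaleR to_completion_add
        to_completion_scaleR A.add A.scaleR)
  moreover have "T (basepoint, e) = 0" for e
    using diff[of basepoint e basepoint]
    by (metis A.zero T_def case_prod_conv cancel_comm_monoid_add_class.diff_cancel tensor_box_diff to_completion_zero)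
  ultimately show T: "T \<in> LipL0" using C(1) by (auto simp: LipL0_def)
  show "linearization T = A" by (rule linearization_eqI[OF A]) (simp add: diff)
qed

lemma dual_ball_eq:
  "blinfun_apply ` (cball 0 1 :: (('x::pointed_metric_space, 'e::real_normed_vector) proj_tensor \<Rightarrow>\<^sub>L real) set)
    = linearization ` LipL0_ball"
proof (intro equalityI subsetI)
  fix A :: "('x, 'e) proj_tensor \<Rightarrow> real" assume "A \<in> blinfun_apply ` cball 0 1"
  then obtain h where h: "A = blinfun_apply h" "norm h \<le> 1" by auto
  have A: "bounded_linear A" unfolding h by (rule blinfun.bounded_linear_right)
  have "norm (A w) \<le> 1 * norm w" for w
    unfolding h(1) using norm_blinfun[of h w] mult_right_mono[OF h(2), of "norm w"] by simp
  then have "(\<lambda>(x, e). A (proj_box x basepoint e)) \<in> LipL0_ball"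
    using LipL0_of_bounded_linear(3)[OF A] LipL0_linear[OF LipL0_of_bounded_linear(1)[OF A]]
      LipL0_basepoint[OF LipL0_of_bounded_linear(1)[OF A]]
    unfolding LipL0_ball_iff by auto
  then show "A \<in> linearization ` LipL0_ball"
    using LipL0_of_bounded_linear(2)[OF A] by (metis imageI)
next
  fix A :: "('x, 'e) proj_tensor \<Rightarrow> real" assume "A \<in> linearization ` LipL0_ball"
  then obtain \<phi> where p: "\<phi> \<in> LipL0_ball" "A = linearization \<phi>" by blast
  note L = LipL0_ball_subset[OF p(1)]
  have A: "blinfun_apply (Blinfun A) = A"
    unfolding p by (rule bounded_linear_Blinfun_apply[OF bounded_linear_linearization[OF L]])
  have "norm (Blinfun A) \<le> 1"
    by (rule norm_blinfun_bound)
      (use norm_linearization_le[OF L, of 1] p A in \<open>auto simp: LipL0_ball_iff\<close>)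
  then show "A \<in> blinfun_apply ` cball 0 1"
    using A by (intro image_eqI[of _ _ "Blinfun A"]) auto
qed

section \<open>Summing inequalities without suprema\<close>

text \<open>
  Inequalities against a supremum of \<open>p\<close>-th roots are inconvenient in limits and integrals. The
  equivalent form quantifies over the upper bounds \<open>M\<close> of the \<open>p\<close>-th powers.
\<close>

lemma powr_le_mult_SUP_iff:
  fixes \<Phi> :: "'b \<Rightarrow> real"
  assumes p: "1 \<le> p" and C: "0 < C" and a: "0 \<le> a" and B: "B \<noteq> {}"
    and nonneg: "\<And>b. b \<in> B \<Longrightarrow> 0 \<le> \<Phi> b" and bdd: "\<And>b. b \<in> B \<Longrightarrow> \<Phi> b \<le> D"
  shows "a powr (1 / p) \<le> C * (SUP b\<in>B. \<Phi> b powr (1 / p))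
    \<longleftrightarrow> (\<forall>M. (\<forall>b\<in>B. \<Phi> b \<le> M) \<longrightarrow> a \<le> C powr p * M)" (is "?l \<longleftrightarrow> ?r")
proof
  have root: "(t powr (1 / p)) powr p = t" if "0 \<le> t" for t :: real
    using p that by (simp add: powr_powr)
  have root': "(t powr p) powr (1 / p) = t" if "0 \<le> t" for t :: real
    using p that by (simp add: powr_powr)
  let ?S = "SUP b\<in>B. \<Phi> b powr (1 / p)"
  show ?r if l: ?l
  proof (intro allI impI)
    fix M assume M: "\<forall>b\<in>B. \<Phi> b \<le> M"
    obtain b where "b \<in> B" using B by blast
    then have M0: "0 \<le> M" using nonneg[of b] M by force
    have "?S \<le> M powr (1 / p)"
      using M nonneg p by (intro cSUP_least[OF B] powr_mono2) auto
    then have "a powr (1 / p) \<le> C * M powr (1 / p)"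
      using l C mult_left_mono[of ?S "M powr (1 / p)" C] by linarith
    then have "(a powr (1 / p)) powr p \<le> (C * M powr (1 / p)) powr p"
      using p by (intro powr_mono2) auto
    then show "a \<le> C powr p * M" using root a M0 C by (simp add: powr_mult)
  qed
  show ?l if r: ?r
  proof -
    have S: "\<Phi> b powr (1 / p) \<le> ?S" if "b \<in> B" for b
    proof (rule cSUP_upper[OF that])
      show "bdd_above ((\<lambda>b. \<Phi> b powr (1 / p)) ` B)"
        using bdd nonneg p by (intro bdd_aboveI2[of _ _ "D powr (1 / p)"] powr_mono2) auto
    qed
    obtain b where "b \<in> B" using B by blast
    then have S0: "0 \<le> ?S" using S[of b] powr_ge_zero order_trans by blast
    have "\<Phi> b \<le> ?S powr p" if "b \<in> B" for b
      using powr_mono2[OF _ _ S[OF that], of p] p root[OF nonneg[OF that]] by simp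
    then have "a \<le> C powr p * ?S powr p" using r by blast
    then have "a powr (1 / p) \<le> (C powr p * ?S powr p) powr (1 / p)"
      using a p by (intro powr_mono2) auto
    then show ?l using root' S0 C by (simp add: powr_mult)
  qed
qed

text \<open>
  The form of both summing inequalities that is free of suprema, for families taken from \<open>S\<close>. The whole
  completion gives \<open>p\<close>-summing operators, the uncompleted tensors give factorable operators.
\<close>

definition dominated_on ::
  "real \<Rightarrow> ('x::pointed_metric_space \<times> 'e::real_normed_vector \<Rightarrow> 'f::real_normed_vector)
     \<Rightarrow> real \<Rightarrow> ('x, 'e) proj_tensor set \<Rightarrow> bool" where
  "dominated_on p T C S \<longleftrightarrow>
     (\<forall>(n::nat) (g :: nat \<Rightarrow> ('x, 'e) proj_tensor) M.
        (\<forall>i. g i \<in> S) \<longrightarrow> (\<forall>\<phi>\<in>LipL0_ball. (\<Sum>i<n. \<bar>linearization \<phi> (g i)\<bar> powr p) \<le> M) \<longrightarrow>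
        (\<Sum>i<n. norm (linearization T (g i)) powr p) \<le> C powr p * M)"

lemma dominated_onD:
  assumes "dominated_on p T C S" "\<And>i. g i \<in> S"
    and "\<And>\<phi>. \<phi> \<in> LipL0_ball \<Longrightarrow> (\<Sum>i<n::nat. \<bar>linearization \<phi> (g i)\<bar> powr p) \<le> M"
  shows "(\<Sum>i<n. norm (linearization T (g i)) powr p) \<le> C powr p * M"
  using assms(1)[unfolded dominated_on_def, rule_format] assms(2,3) by blast

lemma abs_linearization_le_norm: "\<phi> \<in> LipL0_ball \<Longrightarrow> \<bar>linearization \<phi> w\<bar> \<le> norm w"
  using norm_linearization_le[of \<phi> 1 w] LipL0_ball_subset[of \<phi>] by (simp add: LipL0_ball_iff)

lemma powr_sum_linearization_le:
  assumes "1 \<le> p" "\<phi> \<in> LipL0_ball"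
  shows "(\<Sum>i\<in>I. \<bar>linearization \<phi> (g i)\<bar> powr p) \<le> (\<Sum>i\<in>I. norm (g i) powr p)"
  using assms by (intro sum_mono powr_mono2 abs_linearization_le_norm) auto

lemma summing_bound_iff_dominated_on:
  fixes T :: "'x::pointed_metric_space \<times> 'e::real_normed_vector \<Rightarrow> 'f::banach"
  assumes p: "1 \<le> p" and C: "0 < C"
  shows "summing_bound p (linearization T) C \<longleftrightarrow> dominated_on p T C UNIV"
proof -
  have ball: "(\<forall>h\<in>cball 0 1. Q (blinfun_apply h)) \<longleftrightarrow> (\<forall>\<phi>\<in>LipL0_ball. Q (linearization \<phi>))"
    for Q :: "(('x, 'e) proj_tensor \<Rightarrow> real) \<Rightarrow> bool"
  proof -
    have "(\<forall>h\<in>cball 0 1. Q (blinfun_apply h))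
        \<longleftrightarrow> (\<forall>A\<in>blinfun_apply ` (cball 0 1 :: (('x, 'e) proj_tensor \<Rightarrow>\<^sub>L real) set). Q A)" by blast
    also have "\<dots> \<longleftrightarrow> (\<forall>\<phi>\<in>LipL0_ball. Q (linearization \<phi>))" unfolding dual_ball_eq by blast
    finally show ?thesis .
  qed
  have "(\<Sum>i<n. norm (linearization T (g i)) powr p) powr (1 / p)
          \<le> C * (SUP h \<in> cball 0 1. (\<Sum>i<n. \<bar>blinfun_apply h (g i)\<bar> powr p) powr (1 / p))
    \<longleftrightarrow> (\<forall>M. (\<forall>\<phi>\<in>LipL0_ball. (\<Sum>i<n. \<bar>linearization \<phi> (g i)\<bar> powr p) \<le> M) \<longrightarrow>
        (\<Sum>i<n. norm (linearization T (g i)) powr p) \<le> C powr p * M)"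
    for n :: nat and g :: "nat \<Rightarrow> ('x, 'e) proj_tensor"
  proof -
    have "\<forall>h\<in>cball 0 1. (\<Sum>i<n. \<bar>blinfun_apply h (g i)\<bar> powr p) \<le> (\<Sum>i<n. norm (g i) powr p)"
      unfolding ball[of "\<lambda>A. (\<Sum>i<n. \<bar>A (g i)\<bar> powr p) \<le> _"] using powr_sum_linearization_le[OF p] by blast
    then show ?thesis
      unfolding ball[of "\<lambda>A. (\<Sum>i<n. \<bar>A (g i)\<bar> powr p) \<le> _", symmetric]
      by (intro powr_le_mult_SUP_iff[OF p C]) (auto intro: sum_nonneg)
  qed
  then show ?thesis by (simp add: summing_bound_def dominated_on_def)
qed

text \<open>
  A factorable bound uses the same number \<open>m\<close> of summands for all members of a family, so shorter
  representations are padded with vanishing elementary tensors.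
\<close>

lemma tensor_repr_common_length:
  fixes u :: "nat \<Rightarrow> ('x::pointed_metric_space, 'e::real_normed_vector) lip_tensor"
  obtains m :: nat and x y e where "\<forall>i<n. u i = (\<Sum>j<m. tensor_box (x i j) (y i j) (e i j))"
proof -
  have "\<exists>m x y e. u i = (\<Sum>j<m::nat. tensor_box (x j) (y j) (e j))" for i
    by (rule tensor_repr_sum[of "u i"]) blast
  then obtain k x y e where rep: "\<And>i. u i = (\<Sum>j<k i::nat. tensor_box (x i j) (y i j) (e i j))"
    by metis
  define m where "m = (\<Sum>i<n. k i)"
  have "u i = (\<Sum>j<m. tensor_box (x i j) (y i j) (if j < k i then e i j else 0))" if "i < n" for i
  proof -
    have "k i \<le> m" unfolding m_def using that by (intro member_le_sum) auto
    then show ?thesis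
      by (subst rep) (auto intro!: sum.mono_neutral_cong_left simp: tensor_box_zero split: if_splits)
  qed
  then show thesis by (intro that[of x y "\<lambda>i j. if j < k i then e i j else 0" m]) simp
qed

lemma factorable_bound_iff_dominated_on:
  fixes T :: "'x::pointed_metric_space \<times> 'e::real_normed_vector \<Rightarrow> 'f::banach"
  assumes p: "1 \<le> p" and C: "0 < C" and T: "T \<in> LipL0"
  shows "factorable_bound p T C \<longleftrightarrow> dominated_on p T C (range to_completion)"
proof -
  let ?sum = "\<lambda>m x y e i. to_completion (\<Sum>j<m::nat. tensor_box (x i j) (y i j) (e i j))"
  let ?Q = "\<lambda>n g. \<forall>M. (\<forall>\<phi>\<in>LipL0_ball. (\<Sum>i<n::nat. \<bar>linearization \<phi> (g i)\<bar> powr p) \<le> M) \<longrightarrow>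
        (\<Sum>i<n. norm (linearization T (g i)) powr p) \<le> C powr p * M"
  have lin: "linearization \<phi> (?sum m x y e i) = (\<Sum>j<m. \<phi> (x i j, e i j) - \<phi> (y i j, e i j))"
    if "\<phi> \<in> LipL0_ball" for \<phi> m x y e i
    by (rule linearization_sum[OF LipL0_ball_subset[OF that]])
  have "(\<Sum>i<n. norm (\<Sum>j<m. T (x i j, e i j) - T (y i j, e i j)) powr p) powr (1 / p)
          \<le> C * (SUP \<phi> \<in> LipL0_ball.
                    (\<Sum>i<n. \<bar>\<Sum>j<m. \<phi> (x i j, e i j) - \<phi> (y i j, e i j)\<bar> powr p) powr (1 / p))
    \<longleftrightarrow> ?Q n (?sum m x y e)" for n m :: nat and x y e
  proof -
    have "(SUP \<phi> \<in> LipL0_ball. (\<Sum>i<n. \<bar>\<Sum>j<m. \<phi> (x i j, e i j) - \<phi> (y i j, e i j)\<bar> powr p) powr (1 / p))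
      = (SUP \<phi> \<in> LipL0_ball. (\<Sum>i<n. \<bar>linearization \<phi> (?sum m x y e i)\<bar> powr p) powr (1 / p))"
      by (rule SUP_cong) (simp_all add: lin)
    then show ?thesis
      unfolding linearization_sum[OF T, symmetric]
      using zero_in_LipL0_ball powr_sum_linearization_le[OF p]
      by (simp only:) (rule powr_le_mult_SUP_iff[OF p C], auto intro: sum_nonneg)
  qed
  then have "factorable_bound p T C \<longleftrightarrow> (\<forall>n m x y e. ?Q n (?sum m x y e))"
    unfolding factorable_bound_def by simp
  also have "\<dots> \<longleftrightarrow> (\<forall>n g. (\<forall>i. g i \<in> range to_completion) \<longrightarrow> ?Q n g)"
  proof (intro iffI allI impI)
    fix n and g :: "nat \<Rightarrow> ('x, 'e) proj_tensor" and M
    assume *: "\<forall>n m x y e. ?Q n (?sum m x y e)" and g: "\<forall>i. g i \<in> range to_completion"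
      and M: "\<forall>\<phi>\<in>LipL0_ball. (\<Sum>i<n. \<bar>linearization \<phi> (g i)\<bar> powr p) \<le> M"
    have "\<forall>i. \<exists>u. g i = to_completion u" using g by auto
    then obtain u where u: "\<forall>i. g i = to_completion (u i)" by (rule choice[THEN exE])
    obtain m x y e where rep: "\<forall>i<n. u i = (\<Sum>j<m::nat. tensor_box (x i j) (y i j) (e i j))"
      by (rule tensor_repr_common_length[of n u])
    then have g_eq: "g i = ?sum m x y e i" if "i < n" for i using u that by simp
    have "?Q n (?sum m x y e)" using * by blast
    then have "(\<Sum>i<n. norm (linearization T (?sum m x y e i)) powr p) \<le> C powr p * M"
      using M g_eq by simp
    then show "(\<Sum>i<n. norm (linearization T (g i)) powr p) \<le> C powr p * M" using g_eq by simp
  next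
    fix n m :: nat and x y :: "nat \<Rightarrow> nat \<Rightarrow> 'x" and e :: "nat \<Rightarrow> nat \<Rightarrow> 'e" and M
    assume *: "\<forall>n g. (\<forall>i. g i \<in> range to_completion) \<longrightarrow> ?Q n g"
      and M: "\<forall>\<phi>\<in>LipL0_ball. (\<Sum>i<n. \<bar>linearization \<phi> (?sum m x y e i)\<bar> powr p) \<le> M"
    have "?Q n (?sum m x y e)" using *[THEN spec, THEN spec] by simp
    then show "(\<Sum>i<n. norm (linearization T (?sum m x y e i)) powr p) \<le> C powr p * M"
      using M by blast
  qed
  also have "\<dots> \<longleftrightarrow> dominated_on p T C (range to_completion)"
    unfolding dominated_on_def by (simp only: all_simps(6)[symmetric] imp_conjL)
  finally show ?thesis .
qed

text \<open>
  Approximate the \<open>g i\<close> by uncompleted tensors. A member of the ball changes by at most the norm of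
  the difference, and \<open>t \<mapsto> t powr p\<close> is uniformly continuous on bounded intervals, so an upper
  bound \<open>M\<close> for the sums of \<open>p\<close>-th powers deteriorates by an arbitrarily small \<open>e\<close> uniformly on the
  ball; the left-hand side converges.
\<close>

lemma dominated_on_UNIV_iff:
  fixes T :: "'x::pointed_metric_space \<times> 'e::real_normed_vector \<Rightarrow> 'f::banach"
  assumes p: "1 \<le> p" and C: "0 < C" and T: "T \<in> LipL0"
  shows "dominated_on p T C (range to_completion) \<longleftrightarrow> dominated_on p T C UNIV"
proof
  assume D: "dominated_on p T C (range to_completion)"
  show "dominated_on p T C UNIV"
    unfolding dominated_on_def
  proof (intro allI impI)
    fix n and g :: "nat \<Rightarrow> ('x, 'e) proj_tensor" and M
    assume M: "\<forall>\<phi>\<in>LipL0_ball. (\<Sum>i<n. \<bar>linearization \<phi> (g i)\<bar> powr p) \<le> M"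
    have "\<forall>i. \<exists>u. (\<lambda>k. to_completion (u k)) \<longlonglongrightarrow> g i"
      using to_completion_dense by blast
    then obtain u where u: "\<forall>i. (\<lambda>k. to_completion (u i k)) \<longlonglongrightarrow> g i" by (rule choice[THEN exE])
    have lim: "(\<lambda>k. \<Sum>i<n. norm (linearization T (to_completion (u i k))) powr p)
        \<longlonglongrightarrow> (\<Sum>i<n. norm (linearization T (g i)) powr p)"
    proof (rule tendsto_sum)
      fix i
      have "(\<lambda>k. norm (linearization T (to_completion (u i k)))) \<longlonglongrightarrow> norm (linearization T (g i))"
        using u by (intro tendsto_norm bounded_linear.tendsto[OF bounded_linear_linearization[OF T]]) simp
      then show "(\<lambda>k. norm (linearization T (to_completion (u i k))) powr p)
          \<longlonglongrightarrow> norm (linearization T (g i)) powr p"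
        using p by (intro tendsto_powr' tendsto_const) auto
    qed
    show "(\<Sum>i<n. norm (linearization T (g i)) powr p) \<le> C powr p * M"
    proof (rule field_le_epsilon)
      fix e0 :: real assume "0 < e0"
      define e where "e = e0 / C powr p"
      have e: "0 < e" "C powr p * e = e0" using \<open>0 < e0\<close> C by (auto simp: e_def)
      have e': "0 < e / (n + 1)" using e by simp
      \<comment> \<open>The interval \<open>{0..R}\<close> contains all values at the \<open>g i\<close> and at tensors within distance 1 of them.\<close>
      define R where "R = (\<Sum>i<n. norm (g i)) + 1"
      have "uniformly_continuous_on {0..R} (\<lambda>t::real. t powr p)"
        using p by (intro compact_uniformly_continuous continuous_on_powr' continuous_intros) auto
      then obtain d where d: "0 < d" "\<And>s t. s \<in> {0..R} \<Longrightarrow> t \<in> {0..R} \<Longrightarrow> \<bar>s - t\<bar> < d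
          \<Longrightarrow> \<bar>s powr p - t powr p\<bar> < e / (n + 1)"
        unfolding uniformly_continuous_on_def dist_real_def using e'(1) by meson
      have "\<forall>\<^sub>F k in sequentially. \<forall>i\<in>{..<n}. dist (to_completion (u i k)) (g i) < min d 1"
        using u d(1) by (intro eventually_ball_finite ballI tendstoD) auto
      then have "\<forall>\<^sub>F k in sequentially.
          (\<Sum>i<n. norm (linearization T (to_completion (u i k))) powr p) \<le> C powr p * (M + e)"
      proof (rule eventually_mono)
        fix k assume k: "\<forall>i\<in>{..<n}. dist (to_completion (u i k)) (g i) < min d 1"
        have "(\<Sum>i<n. \<bar>linearization \<phi> (to_completion (u i k))\<bar> powr p) \<le> M + e"
          if phi: "\<phi> \<in> LipL0_ball" for \<phi>
        proof -
          have "\<bar>linearization \<phi> (to_completion (u i k))\<bar> powr p \<le> \<bar>linearization \<phi> (g i)\<bar> powr p + e / (n + 1)"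
            if i: "i < n" for i
          proof -
            let ?s = "linearization \<phi> (to_completion (u i k))" and ?t = "linearization \<phi> (g i)"
            have "?s - ?t = linearization \<phi> (to_completion (u i k) - g i)"
              using linear_diff[OF bounded_linear.linear[OF
                bounded_linear_linearization[OF LipL0_ball_subset[OF phi]]]] by simp
            then have "\<bar>?s - ?t\<bar> \<le> norm (to_completion (u i k) - g i)"
              using abs_linearization_le_norm[OF phi] by simp
            also have "\<dots> < min d 1" using k i by (simp add: dist_norm)
            finally have st: "\<bar>?s - ?t\<bar> < d" "\<bar>?s - ?t\<bar> < 1" by auto
            have "norm (g i) \<le> (\<Sum>i<n. norm (g i))" using i by (intro member_le_sum) auto
            then have "\<bar>?t\<bar> \<le> R - 1" using abs_linearization_le_norm[OF phi, of "g i"] by (simp add: R_def)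
            then have "\<bar>\<bar>?s\<bar> powr p - \<bar>?t\<bar> powr p\<bar> < e / (n + 1)"
              using st by (intro d(2)) auto
            then show ?thesis by linarith
          qed
          then have "(\<Sum>i<n. \<bar>linearization \<phi> (to_completion (u i k))\<bar> powr p)
              \<le> (\<Sum>i<n. \<bar>linearization \<phi> (g i)\<bar> powr p + e / (n + 1))"
            by (intro sum_mono) auto
          also have "\<dots> = (\<Sum>i<n. \<bar>linearization \<phi> (g i)\<bar> powr p) + n * (e / (n + 1))"
            by (simp add: sum.distrib)
          also have "\<dots> \<le> M + e" using M phi e(1) by (intro add_mono) (auto simp: field_simps)
          finally show ?thesis .
        qed
        then show "(\<Sum>i<n. norm (linearization T (to_completion (u i k))) powr p) \<le> C powr p * (M + e)"
          by (intro dominated_onD[OF D]) auto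
      qed
      from tendsto_upperbound[OF lim this] e(2)
      show "(\<Sum>i<n. norm (linearization T (g i)) powr p) \<le> C powr p * M + e0"
        by (simp add: distrib_left)
    qed
  qed
qed (simp add: dominated_on_def)

section \<open>Pietsch domination on the ball\<close>

text \<open>
  Restricted to the ball, the value at an uncompleted tensor is a finite combination of point
  evaluations. For a general element of the completion this fails to be immediate, which is why the
  measure is constructed on the range of \<open>to_completion\<close>.
\<close>

lemma continuous_on_linearization:
  fixes u :: "('x::pointed_metric_space, 'e::real_normed_vector) lip_tensor"
  assumes p: "1 \<le> p"
  shows "continuous_on LipL0_ball (\<lambda>\<phi>. \<bar>linearization \<phi> (to_completion u)\<bar> powr p)"
proof -
  obtain n x y e where u: "u = (\<Sum>i<n::nat. tensor_box (x i) (y i) (e i))" by (rule tensor_repr_sum)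
  have "continuous_on LipL0_ball (\<lambda>\<phi> :: 'x \<times> 'e \<Rightarrow> real. \<bar>\<Sum>i<n. \<phi> (x i, e i) - \<phi> (y i, e i)\<bar> powr p)"
    using p by (intro continuous_on_powr' continuous_intros
        continuous_on_subset[OF continuous_on_product_coordinates]) auto
  then show ?thesis
    by (rule continuous_on_eq) (simp add: u linearization_sum LipL0_ball_subset)
qed

lemma integrable_linearization:
  fixes u :: "('x::pointed_metric_space, 'e::real_normed_vector) lip_tensor"
  assumes p: "1 \<le> p" and \<mu>: "regular_prob_on LipL0_ball \<mu>"
  shows "integrable \<mu> (\<lambda>\<phi>. \<bar>linearization \<phi> (to_completion u)\<bar> powr p)"
proof -
  have m: "prob_space \<mu>" "space \<mu> = LipL0_ball" "sets \<mu> = sets (restrict_space borel LipL0_ball)"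
    using \<mu> by (auto simp: regular_prob_on_def)
  interpret prob_space \<mu> by fact
  show ?thesis
  proof (rule integrable_const_bound)
    show "AE \<phi> in \<mu>. norm (\<bar>linearization \<phi> (to_completion u)\<bar> powr p) \<le> norm (to_completion u) powr p"
      using p by (intro AE_I2) (auto simp: m intro!: powr_mono2 abs_linearization_le_norm)
    show "(\<lambda>\<phi>. \<bar>linearization \<phi> (to_completion u)\<bar> powr p) \<in> borel_measurable \<mu>"
      using borel_measurable_continuous_on_restrict[OF continuous_on_linearization[OF p]]
        measurable_cong_sets[OF m(3) refl] by blast
  qed
qed

text \<open>
  One direction is the domination theorem for the cone of all weighted sums over finite families,
  where the weight \<open>a i\<close> is absorbed into the \<open>i\<close>-th tensor as the factor \<open>a i powr (1 / p)\<close>. Conversely, the integral over a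
  probability measure is at most any upper bound of the integrand.
\<close>

lemma dominated_on_iff_measure:
  fixes T :: "'x::pointed_metric_space \<times> 'e::real_normed_vector \<Rightarrow> 'f::banach"
  assumes p: "1 \<le> p" and C: "0 < C" and T: "T \<in> LipL0"
  shows "dominated_on p T C (range to_completion) \<longleftrightarrow>
    (\<exists>\<mu>. regular_prob_on LipL0_ball \<mu> \<and>
      (\<forall>u. norm (linearization T (to_completion u))
        \<le> C * (LINT \<phi>|\<mu>. \<bar>linearization \<phi> (to_completion u)\<bar> powr p) powr (1 / p)))"
    (is "?l \<longleftrightarrow> (\<exists>\<mu>. ?r \<mu>)")
proof
  assume D: ?l
  let ?f = "\<lambda>n a u \<phi>. \<Sum>i<n::nat. a i * \<bar>linearization \<phi> (to_completion (u i))\<bar> powr p"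
  let ?b = "\<lambda>n a u. (\<Sum>i<n::nat. a i * (norm (linearization T (to_completion (u i))) powr p / C powr p))"
  define P :: "((('x \<times> 'e \<Rightarrow> real) \<Rightarrow> real) \<times> real) set"
    where "P = {(?f n a u, ?b n a u) | n a u. \<forall>i. 0 \<le> a i}"
  have PI: "(f, b) \<in> P" if "f = ?f n a u" "b = ?b n a u" "\<forall>i. 0 \<le> a i" for f b n a u
    unfolding P_def using that by blast
  have PE: "\<exists>n a u. f = ?f n a u \<and> b = ?b n a u \<and> (\<forall>i. 0 \<le> a i)" if "(f, b) \<in> P" for f b
    using that unfolding P_def by blast
  have cont: "continuous_on LipL0_ball f" if "(f, b) \<in> P" for f b
    using PE[OF that] by (auto intro!: continuous_intros continuous_on_linearization[OF p])
  have cone: "dominated_cone LipL0_ball P"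
  proof
    show "(LipL0_ball :: ('x \<times> 'e \<Rightarrow> real) set) \<noteq> {}" using zero_in_LipL0_ball by blast
    show "bounded (f ` LipL0_ball)" if "(f, b) \<in> P" for f b
      using compact_imp_bounded[OF compact_continuous_image[OF cont[OF that] compact_LipL0_ball]] .
    show "(\<lambda>_. 0, 0) \<in> P" by (rule PI[of _ "\<lambda>_. 0" _ 0]) auto
    show "(\<lambda>\<phi>. f \<phi> + g \<phi>, b + c) \<in> P" if fP: "(f, b) \<in> P" and gP: "(g, c) \<in> P" for f b g c
    proof -
      obtain n a u where f: "f = ?f n a u" "b = ?b n a u" "\<forall>i. 0 \<le> a i" using PE[OF fP] by blast
      obtain m a' u' where g: "g = ?f m a' u'" "c = ?b m a' u'" "\<forall>i. 0 \<le> a' i" using PE[OF gP] by blast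
      let ?a = "\<lambda>i. if i < n then a i else a' (i - n)" and ?u = "\<lambda>i. if i < n then u i else u' (i - n)"
      show ?thesis
      proof (rule PI[of _ ?a ?u "n + m"])
        show "(\<lambda>\<phi>. f \<phi> + g \<phi>) = ?f (n + m) ?a ?u"
          unfolding f g sum_lessThan_append[symmetric] by (intro ext sum.cong) auto
        show "b + c = ?b (n + m) ?a ?u"
          unfolding f g sum_lessThan_append[symmetric] by (intro sum.cong) auto
      qed (simp add: f g)
    qed
    show "(\<lambda>\<phi>. t * f \<phi>, t * b) \<in> P" if fP: "(f, b) \<in> P" and t: "0 \<le> t" for f b t
    proof -
      obtain n a u where f: "f = ?f n a u" "b = ?b n a u" "\<forall>i. 0 \<le> a i" using PE[OF fP] by blast
      show ?thesis
        by (rule PI[of _ "\<lambda>i. t * a i" u n]) (use f t in \<open>auto simp: sum_distrib_left mult.assoc\<close>)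
    qed
    show "b \<le> M" if fP: "(f, b) \<in> P" and M: "\<And>\<phi>. \<phi> \<in> LipL0_ball \<Longrightarrow> f \<phi> \<le> M" for f b M
    proof -
      obtain n a u where f: "f = ?f n a u" "b = ?b n a u" "\<forall>i. 0 \<le> a i" using PE[OF fP] by blast
      let ?u = "\<lambda>i. to_completion ((a i powr (1 / p)) *\<^sub>R u i)"
      have absorb: "norm (linearization S (?u i)) powr p = a i * norm (linearization S (to_completion (u i))) powr p"
        if "S \<in> LipL0" for S :: "'x \<times> 'e \<Rightarrow> 'g::banach" and i
        using f(3) p
        by (simp add: to_completion_scaleR powr_mult powr_powr
            linear_scale[OF bounded_linear.linear[OF bounded_linear_linearization[OF that]]])
      have "(\<Sum>i<n. \<bar>linearization \<phi> (?u i)\<bar> powr p) \<le> M" if "\<phi> \<in> LipL0_ball" for \<phi>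
        using M[OF that] absorb[OF LipL0_ball_subset[OF that]] by (simp add: f)
      then have "(\<Sum>i<n. norm (linearization T (?u i)) powr p) \<le> C powr p * M"
        by (intro dominated_onD[OF D]) auto
      then show ?thesis
        using C by (simp add: f absorb[OF T] field_simps flip: sum_divide_distrib)
    qed
  qed
  have nonneg: "0 \<le> f \<phi>" if "(f, b) \<in> P" for f b \<phi>
    using PE[OF that] by (auto intro: sum_nonneg)
  have "Hausdorff_space (product_topology (\<lambda>_ :: 'x \<times> 'e. euclidean :: real topology) UNIV)"
    by (simp add: Hausdorff_space_product_topology)
  then have Hausdorff: "Hausdorff_space (euclidean :: ('x \<times> 'e \<Rightarrow> real) topology)"
    by (simp add: euclidean_product_topology)
  have "\<exists>\<mu>. regular_prob_on LipL0_ball \<mu> \<and> (\<forall>(f, b)\<in>P. b \<le> (LINT \<phi>|\<mu>. f \<phi>))"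
  proof (rule regular_domination[OF Hausdorff cone compact_LipL0_ball])
    show "continuous_on LipL0_ball f" if "(f, b) \<in> P" for f b by (rule cont[OF that])
    show "0 \<le> f \<phi>" if "(f, b) \<in> P" for f b \<phi> by (rule nonneg[OF that])
  qed
  then obtain \<mu> where \<mu>: "regular_prob_on LipL0_ball \<mu>" "\<And>f b. (f, b) \<in> P \<Longrightarrow> b \<le> (LINT \<phi>|\<mu>. f \<phi>)"
    by blast
  have "norm (linearization T (to_completion u))
        \<le> C * (LINT \<phi>|\<mu>. \<bar>linearization \<phi> (to_completion u)\<bar> powr p) powr (1 / p)" for u
  proof -
    let ?t = "norm (linearization T (to_completion u))"
    let ?I = "LINT \<phi>|\<mu>. \<bar>linearization \<phi> (to_completion u)\<bar> powr p"
    have "?t powr p / C powr p \<le> ?I"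
      by (rule \<mu>(2), rule PI[of _ "\<lambda>_. 1" "\<lambda>_. u" 1]) auto
    then have "?t powr p \<le> C powr p * ?I" using C by (simp add: field_simps)
    then have "(?t powr p) powr (1 / p) \<le> (C powr p * ?I) powr (1 / p)"
      using p by (intro powr_mono2) auto
    moreover have "0 \<le> ?I" by simp
    ultimately show ?thesis using p C by (simp add: powr_powr powr_mult)
  qed
  then show "\<exists>\<mu>. ?r \<mu>" using \<mu>(1) by blast
next
  assume "\<exists>\<mu>. ?r \<mu>"
  then obtain \<mu> where \<mu>: "regular_prob_on LipL0_ball \<mu>" and
    bound: "\<And>u. norm (linearization T (to_completion u))
        \<le> C * (LINT \<phi>|\<mu>. \<bar>linearization \<phi> (to_completion u)\<bar> powr p) powr (1 / p)" by blast
  interpret prob_space \<mu> using \<mu> by (simp add: regular_prob_on_def)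
  show ?l
    unfolding dominated_on_def
  proof (intro allI impI)
    fix n and g :: "nat \<Rightarrow> ('x, 'e) proj_tensor" and M
    assume g: "\<forall>i. g i \<in> range to_completion"
      and M: "\<forall>\<phi>\<in>LipL0_ball. (\<Sum>i<n. \<bar>linearization \<phi> (g i)\<bar> powr p) \<le> M"
    have int: "integrable \<mu> (\<lambda>\<phi>. \<bar>linearization \<phi> (g i)\<bar> powr p)" for i
      using g integrable_linearization[OF p \<mu>] by (metis imageE)
    have "norm (linearization T (g i)) powr p \<le> C powr p * (LINT \<phi>|\<mu>. \<bar>linearization \<phi> (g i)\<bar> powr p)" for i
    proof -
      let ?I = "LINT \<phi>|\<mu>. \<bar>linearization \<phi> (g i)\<bar> powr p"
      have "norm (linearization T (g i)) \<le> C * ?I powr (1 / p)" using g bound by (metis imageE)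
      then have "norm (linearization T (g i)) powr p \<le> (C * ?I powr (1 / p)) powr p"
        using p by (intro powr_mono2) auto
      moreover have "0 \<le> ?I" by simp
      ultimately show ?thesis using p C by (simp add: powr_powr powr_mult)
    qed
    then have "(\<Sum>i<n. norm (linearization T (g i)) powr p)
        \<le> C powr p * (\<Sum>i<n. LINT \<phi>|\<mu>. \<bar>linearization \<phi> (g i)\<bar> powr p)"
      by (simp add: sum_distrib_left sum_mono)
    also have "(\<Sum>i<n. LINT \<phi>|\<mu>. \<bar>linearization \<phi> (g i)\<bar> powr p)
        = (LINT \<phi>|\<mu>. (\<Sum>i<n. \<bar>linearization \<phi> (g i)\<bar> powr p))"
      using int by (simp add: Bochner_Integration.integral_sum)
    also have "\<dots> \<le> (LINT \<phi>|\<mu>. M)"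
      using M \<mu> int by (intro integral_mono) (auto simp: regular_prob_on_def)
    also have "(LINT \<phi>|\<mu>. M) = M" by (simp add: prob_space)
    finally show "(\<Sum>i<n. norm (linearization T (g i)) powr p) \<le> C powr p * M"
      using C by (simp add: mult_left_mono)
  qed
qed

text \<open>
  The measure lives on the ball, where linearizations of tensors are the sums of differences.
\<close>

lemma factorable_bound_iff_measure:
  fixes T :: "'x::pointed_metric_space \<times> 'e::real_normed_vector \<Rightarrow> 'f::banach"
  assumes p: "1 \<le> p" and C: "0 < C" and T: "T \<in> LipL0"
  shows "factorable_bound p T C \<longleftrightarrow>
    (\<exists>\<mu>. regular_prob_on LipL0_ball \<mu> \<and>
      (\<forall>(m::nat) x y e. norm (\<Sum>j<m. T (x j, e j) - T (y j, e j))
        \<le> C * (LINT \<phi>|\<mu>. \<bar>\<Sum>j<m. \<phi> (x j, e j) - \<phi> (y j, e j)\<bar> powr p) powr (1 / p)))"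
proof -
  have "(\<forall>u. norm (linearization T (to_completion u))
        \<le> C * (LINT \<phi>|\<mu>. \<bar>linearization \<phi> (to_completion u)\<bar> powr p) powr (1 / p))
    \<longleftrightarrow> (\<forall>(m::nat) x y e. norm (\<Sum>j<m. T (x j, e j) - T (y j, e j))
        \<le> C * (LINT \<phi>|\<mu>. \<bar>\<Sum>j<m. \<phi> (x j, e j) - \<phi> (y j, e j)\<bar> powr p) powr (1 / p))"
    (is "(\<forall>u. ?Q u) \<longleftrightarrow> ?r") if \<mu>: "regular_prob_on LipL0_ball \<mu>" for \<mu>
  proof -
    have "?Q (\<Sum>j<m. tensor_box (x j) (y j) (e j)) \<longleftrightarrow> norm (\<Sum>j<m. T (x j, e j) - T (y j, e j))
        \<le> C * (LINT \<phi>|\<mu>. \<bar>\<Sum>j<m. \<phi> (x j, e j) - \<phi> (y j, e j)\<bar> powr p) powr (1 / p)"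
      for m :: nat and x y e
    proof -
      have "(LINT \<phi>|\<mu>. \<bar>linearization \<phi> (to_completion (\<Sum>j<m. tensor_box (x j) (y j) (e j)))\<bar> powr p)
          = (LINT \<phi>|\<mu>. \<bar>\<Sum>j<m. \<phi> (x j, e j) - \<phi> (y j, e j)\<bar> powr p)"
        using \<mu> by (intro Bochner_Integration.integral_cong)
          (auto simp: regular_prob_on_def linearization_sum LipL0_ball_subset)
      then show ?thesis by (simp add: linearization_sum[OF T])
    qed
    note sums = this
    show ?thesis
    proof
      assume "\<forall>u. ?Q u"
      then show ?r unfolding sums[symmetric] by blast
    next
      assume r: ?r
      show "\<forall>u. ?Q u"
      proof
        fix u :: "('x, 'e) lip_tensor"
        obtain m x y e where u: "u = (\<Sum>j<m::nat. tensor_box (x j) (y j) (e j))"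
          by (rule tensor_repr_sum)
        show "?Q u" unfolding u sums using r by blast
      qed
    qed
  qed
  then show ?thesis
    unfolding factorable_bound_iff_dominated_on[OF assms] dominated_on_iff_measure[OF assms] by blast
qed

section \<open>The isometric identification\<close>

text \<open>
  The equivalence holds for each constant, so it gives both the set equality and the equality of
  norms.
\<close>

lemma factorable_bound_iff_summing_bound:
  fixes T :: "'x::pointed_metric_space \<times> 'e::real_normed_vector \<Rightarrow> 'f::banach"
  assumes "1 \<le> p" "0 < C" "T \<in> LipL0"
  shows "factorable_bound p T C \<longleftrightarrow> summing_bound p (linearization T) C"
  using assms by (simp add: factorable_bound_iff_dominated_on dominated_on_UNIV_iff
      summing_bound_iff_dominated_on)

lemma factorable_ops_iff_summing_ops:
  fixes T :: "'x::pointed_metric_space \<times> 'e::real_normed_vector \<Rightarrow> 'f::banach"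
  assumes "1 \<le> p" "T \<in> LipL0"
  shows "T \<in> factorable_ops p \<longleftrightarrow> linearization T \<in> summing_ops p"
  using assms bounded_linear.linear[OF bounded_linear_linearization[OF assms(2)]]
  by (auto simp: factorable_ops_def summing_ops_def factorable_bound_iff_summing_bound)

lemma factorable_norm_eq_summing_norm:
  fixes T :: "'x::pointed_metric_space \<times> 'e::real_normed_vector \<Rightarrow> 'f::banach"
  assumes "1 \<le> p" "T \<in> LipL0"
  shows "factorable_norm p T = summing_norm p (linearization T)"
  unfolding factorable_norm_def summing_norm_def
  using factorable_bound_iff_summing_bound[OF assms(1) _ assms(2)] by metis

text \<open>
  The summing inequality for a family with one member.
\<close>

lemma summing_bound_imp_bounded_linear:
  fixes A :: "'g::real_normed_vector \<Rightarrow> 'f::real_normed_vector"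
  assumes p: "1 \<le> p" and A: "linear A" and C: "0 < C" "summing_bound p A C"
  shows "bounded_linear A"
proof (rule bounded_linear_intro)
  show "norm (A g) \<le> norm g * C" for g
  proof -
    have "(SUP h \<in> (cball 0 1 :: ('g \<Rightarrow>\<^sub>L real) set). \<bar>blinfun_apply h g\<bar>) \<le> norm g"
    proof (rule cSUP_least)
      fix h :: "'g \<Rightarrow>\<^sub>L real" assume "h \<in> cball 0 1"
      then show "\<bar>blinfun_apply h g\<bar> \<le> norm g"
        using norm_blinfun[of h g] mult_right_mono[of "norm h" 1 "norm g"] by simp
    qed simp
    moreover have "norm (A g) \<le> C * (SUP h \<in> (cball 0 1 :: ('g \<Rightarrow>\<^sub>L real) set). \<bar>blinfun_apply h g\<bar>)"
      using C(2)[unfolded summing_bound_def, rule_format, of "\<lambda>_. g" 1] p by (simp add: powr_powr)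
    ultimately show ?thesis
      using C(1) by (metis mult.commute mult_left_mono order_trans less_imp_le)
  qed
qed (use A in \<open>auto simp: linear_add linear_scale\<close>)

text \<open>
  Injectivity uses the base point: \<open>R (x, e)\<close> is the value of the linearization at \<open>proj_box x basepoint e\<close>.
\<close>

lemma bij_betw_linearization:
  assumes p: "1 \<le> p"
  shows "bij_betw linearization
        (factorable_ops p :: ('x::pointed_metric_space \<times> 'e::real_normed_vector \<Rightarrow> 'f::banach) set)
        (summing_ops p :: (('x, 'e) proj_tensor \<Rightarrow> 'f) set)"
  unfolding bij_betw_def
proof
  show "inj_on linearization (factorable_ops p :: ('x \<times> 'e \<Rightarrow> 'f) set)"
  proof (rule inj_onI)
    fix R S :: "'x \<times> 'e \<Rightarrow> 'f"
    assume "R \<in> factorable_ops p" "S \<in> factorable_ops p" and eq: "linearization R = linearization S"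
    then have RS: "R \<in> LipL0" "S \<in> LipL0" by (auto simp: factorable_ops_def)
    have "R (x, e) = S (x, e)" for x e
      using linearization_box[OF RS(1), of x basepoint e] linearization_box[OF RS(2), of x basepoint e] eq
      by (simp add: LipL0_basepoint RS)
    then show "R = S" by auto
  qed
  show "linearization ` (factorable_ops p :: ('x \<times> 'e \<Rightarrow> 'f) set) = summing_ops p"
  proof (intro equalityI subsetI)
    fix A :: "('x, 'e) proj_tensor \<Rightarrow> 'f"
    assume "A \<in> linearization ` factorable_ops p"
    then show "A \<in> summing_ops p"
      using factorable_ops_iff_summing_ops[OF p] by (auto simp: factorable_ops_def)
  next
    fix A :: "('x, 'e) proj_tensor \<Rightarrow> 'f" assume A: "A \<in> summing_ops p"
    then have "bounded_linear A"
      using summing_bound_imp_bounded_linear[OF p] by (auto simp: summing_ops_def)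
    from LipL0_of_bounded_linear(1,2)[OF this] obtain T where "T \<in> LipL0" "linearization T = A" by blast
    then show "A \<in> linearization ` factorable_ops p"
      using factorable_ops_iff_summing_ops[OF p, of T] A by blast
  qed
qed

lemma LipL0_linear_combination:
  assumes R: "R \<in> LipL0" and S: "S \<in> LipL0"
  shows "(\<lambda>z. a *\<^sub>R R z + b *\<^sub>R S z) \<in> LipL0"
proof -
  obtain C D where C: "0 < C" "lip_linear_bound R C" and D: "0 < D" "lip_linear_bound S D"
    using LipL0_bound[OF R] LipL0_bound[OF S] by blast
  let ?E = "\<bar>a\<bar> * C + \<bar>b\<bar> * D + 1"
  have "norm ((a *\<^sub>R R (x, e) + b *\<^sub>R S (x, e)) - (a *\<^sub>R R (y, e) + b *\<^sub>R S (y, e)))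
      \<le> ?E * dist x y * norm e" for x y e
  proof -
    have "norm ((a *\<^sub>R R (x, e) + b *\<^sub>R S (x, e)) - (a *\<^sub>R R (y, e) + b *\<^sub>R S (y, e)))
        = norm (a *\<^sub>R (R (x, e) - R (y, e)) + b *\<^sub>R (S (x, e) - S (y, e)))"
      by (simp add: algebra_simps)
    also have "\<dots> \<le> \<bar>a\<bar> * norm (R (x, e) - R (y, e)) + \<bar>b\<bar> * norm (S (x, e) - S (y, e))"
      by (rule norm_triangle_le) simp
    also have "\<dots> \<le> \<bar>a\<bar> * (C * dist x y * norm e) + \<bar>b\<bar> * (D * dist x y * norm e)"
      using C D by (intro add_mono mult_left_mono) (auto simp: lip_linear_bound_def)
    also have "\<dots> \<le> ?E * dist x y * norm e" by (simp add: algebra_simps)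
    finally show ?thesis .
  qed
  then have "lip_linear_bound (\<lambda>z. a *\<^sub>R R z + b *\<^sub>R S z) ?E" by (simp add: lip_linear_bound_def)
  moreover have "0 < ?E" using C D by (intro add_nonneg_pos add_nonneg_nonneg) auto
  moreover have "linear (\<lambda>e. a *\<^sub>R R (x, e) + b *\<^sub>R S (x, e))" for x
    using LipL0_linear[OF R] LipL0_linear[OF S]
    by (intro linear_compose_add linear_compose_scale_right)
  ultimately show ?thesis using LipL0_basepoint[OF R] LipL0_basepoint[OF S] by (auto simp: LipL0_def)
qed

lemma linearization_linear_combination:
  fixes R S :: "'x::pointed_metric_space \<times> 'e::real_normed_vector \<Rightarrow> 'f::banach"
  assumes R: "R \<in> LipL0" and S: "S \<in> LipL0"
  shows "linearization (\<lambda>z. a *\<^sub>R R z + b *\<^sub>R S z)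
    = (\<lambda>w. a *\<^sub>R linearization R w + b *\<^sub>R linearization S w)"
proof (rule linearization_eqI)
  show "bounded_linear (\<lambda>w. a *\<^sub>R linearization R w + b *\<^sub>R linearization S w)"
    using bounded_linear_linearization[OF R] bounded_linear_linearization[OF S]
    by (intro bounded_linear_add bounded_linear_const_scaleR)
qed (simp add: linearization_box R S algebra_simps)

text \<open>
  A crude substitute for Minkowski's inequality, enough to see that a linear combination of factorable
  operators has some finite constant.
\<close>

lemma powr_add_le:
  fixes s t p :: real
  assumes "0 \<le> s" "0 \<le> t" "0 \<le> p"
  shows "(s + t) powr p \<le> 2 powr p * (s powr p + t powr p)"
proof -
  have "(s + t) powr p \<le> (2 * max s t) powr p" using assms by (intro powr_mono2) auto
  also have "\<dots> = 2 powr p * max s t powr p" using assms by (simp add: powr_mult)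
  also have "max s t powr p \<le> s powr p + t powr p" by (simp add: max_def)
  finally show ?thesis by simp
qed

lemma factorable_ops_linear_combination:
  fixes R S :: "'x::pointed_metric_space \<times> 'e::real_normed_vector \<Rightarrow> 'f::banach"
  assumes p: "1 \<le> p" and R: "R \<in> factorable_ops p" and S: "S \<in> factorable_ops p"
  shows "(\<lambda>z. a *\<^sub>R R z + b *\<^sub>R S z) \<in> factorable_ops p"
proof -
  let ?D = "range to_completion"
  have RS: "R \<in> LipL0" "S \<in> LipL0" using R S by (auto simp: factorable_ops_def)
  obtain C1 C2 where C: "0 < C1" "dominated_on p R C1 ?D" "0 < C2" "dominated_on p S C2 ?D"
    using R S RS factorable_bound_iff_dominated_on[OF p] by (auto simp: factorable_ops_def)
  define E where "E = 2 powr p * (\<bar>a\<bar> powr p * C1 powr p + \<bar>b\<bar> powr p * C2 powr p)"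
  \<comment> \<open>The summand 1 only ensures that the constant is positive.\<close>
  define C where "C = E powr (1 / p) + 1"
  have E: "0 \<le> E" by (simp add: E_def)
  have C0: "0 < C" by (simp add: C_def add_nonneg_pos)
  have "E = (E powr (1 / p)) powr p" using p E by (simp add: powr_powr)
  also have "\<dots> \<le> C powr p" using p by (intro powr_mono2) (auto simp: C_def)
  finally have EC: "E \<le> C powr p" .
  have T: "(\<lambda>z. a *\<^sub>R R z + b *\<^sub>R S z) \<in> LipL0" by (rule LipL0_linear_combination[OF RS])
  have "dominated_on p (\<lambda>z. a *\<^sub>R R z + b *\<^sub>R S z) C ?D"
    unfolding dominated_on_def linearization_linear_combination[OF RS]
  proof (intro allI impI)
    fix n and g :: "nat \<Rightarrow> ('x, 'e) proj_tensor" and M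
    assume g: "\<forall>i. g i \<in> ?D"
      and M: "\<forall>\<phi>\<in>LipL0_ball. (\<Sum>i<n. \<bar>linearization \<phi> (g i)\<bar> powr p) \<le> M"
    have M0: "0 \<le> M"
      by (rule order_trans[OF sum_nonneg bspec[OF M zero_in_LipL0_ball]]) simp
    let ?r = "\<lambda>i. norm (linearization R (g i))" and ?s = "\<lambda>i. norm (linearization S (g i))"
    have "norm (a *\<^sub>R linearization R (g i) + b *\<^sub>R linearization S (g i)) powr p
        \<le> 2 powr p * (\<bar>a\<bar> powr p * ?r i powr p + \<bar>b\<bar> powr p * ?s i powr p)" for i
    proof -
      have "norm (a *\<^sub>R linearization R (g i) + b *\<^sub>R linearization S (g i)) \<le> \<bar>a\<bar> * ?r i + \<bar>b\<bar> * ?s i"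
        by (rule norm_triangle_le) simp
      then have "norm (a *\<^sub>R linearization R (g i) + b *\<^sub>R linearization S (g i)) powr p
          \<le> (\<bar>a\<bar> * ?r i + \<bar>b\<bar> * ?s i) powr p"
        using p by (intro powr_mono2) auto
      also have "\<dots> \<le> 2 powr p * ((\<bar>a\<bar> * ?r i) powr p + (\<bar>b\<bar> * ?s i) powr p)"
        using p by (intro powr_add_le) auto
      finally show ?thesis by (simp add: powr_mult)
    qed
    then have "(\<Sum>i<n. norm (a *\<^sub>R linearization R (g i) + b *\<^sub>R linearization S (g i)) powr p)
        \<le> (\<Sum>i<n. 2 powr p * (\<bar>a\<bar> powr p * ?r i powr p + \<bar>b\<bar> powr p * ?s i powr p))"
      by (rule sum_mono)
    also have "\<dots> = 2 powr p * (\<bar>a\<bar> powr p * (\<Sum>i<n. ?r i powr p) + \<bar>b\<bar> powr p * (\<Sum>i<n. ?s i powr p))"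
      by (simp only: sum_distrib_left distrib_left sum.distrib)
    also have "\<dots> \<le> 2 powr p * (\<bar>a\<bar> powr p * (C1 powr p * M) + \<bar>b\<bar> powr p * (C2 powr p * M))"
      using g M by (intro mult_left_mono add_mono dominated_onD[OF C(2)] dominated_onD[OF C(4)]) auto
    also have "\<dots> = E * M" by (simp add: E_def algebra_simps)
    also have "\<dots> \<le> C powr p * M" using EC M0 by (rule mult_right_mono)
    finally show "(\<Sum>i<n. norm (a *\<^sub>R linearization R (g i) + b *\<^sub>R linearization S (g i)) powr p)
        \<le> C powr p * M" .
  qed
  then show ?thesis
    using T C0 factorable_bound_iff_dominated_on[OF p C0 T] by (auto simp: factorable_ops_def)
qed

theorem theorem4p4:
  fixes p :: real
    and T :: "'x::pointed_metric_space \<times> 'e::banach \<Rightarrow> 'f::banach"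
  assumes "1 \<le> p" and "T \<in> LipL0"
  shows "(T \<in> factorable_ops p \<longleftrightarrow> linearization T \<in> summing_ops p)
    \<and> (T \<in> factorable_ops p \<longleftrightarrow>
        (\<exists>(\<mu> :: ('x \<times> 'e \<Rightarrow> real) measure) C. regular_prob_on LipL0_ball \<mu> \<and> C > 0 \<and>
          (\<forall>(m::nat) (x :: nat \<Rightarrow> 'x) (y :: nat \<Rightarrow> 'x) (e :: nat \<Rightarrow> 'e).
             norm (\<Sum>j<m. T (x j, e j) - T (y j, e j))
               \<le> C * (LINT \<phi>|\<mu>. \<bar>\<Sum>j<m. \<phi> (x j, e j) - \<phi> (y j, e j)\<bar> powr p) powr (1 / p))))
    \<and> bij_betw linearization
        (factorable_ops p :: ('x \<times> 'e \<Rightarrow> 'f) set)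
        (summing_ops p :: (('x, 'e) proj_tensor \<Rightarrow> 'f) set)
    \<and> (\<forall>R \<in> (factorable_ops p :: ('x \<times> 'e \<Rightarrow> 'f) set). \<forall>S \<in> factorable_ops p. \<forall>a b.
        (\<lambda>z. a *\<^sub>R R z + b *\<^sub>R S z) \<in> factorable_ops p \<and>
        linearization (\<lambda>z. a *\<^sub>R R z + b *\<^sub>R S z)
          = (\<lambda>w. a *\<^sub>R linearization R w + b *\<^sub>R linearization S w))
    \<and> (\<forall>R \<in> (factorable_ops p :: ('x \<times> 'e \<Rightarrow> 'f) set).
        factorable_norm p R = summing_norm p (linearization R))"
proof (intro conjI ballI allI)
  show "T \<in> factorable_ops p \<longleftrightarrow> linearization T \<in> summing_ops p"
    by (rule factorable_ops_iff_summing_ops[OF assms])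
  let ?dom = "\<lambda>(\<mu> :: ('x \<times> 'e \<Rightarrow> real) measure) C.
      \<forall>(m::nat) (x :: nat \<Rightarrow> 'x) (y :: nat \<Rightarrow> 'x) (e :: nat \<Rightarrow> 'e).
        norm (\<Sum>j<m. T (x j, e j) - T (y j, e j))
          \<le> C * (LINT \<phi>|\<mu>. \<bar>\<Sum>j<m. \<phi> (x j, e j) - \<phi> (y j, e j)\<bar> powr p) powr (1 / p)"
  have iff: "factorable_bound p T C \<longleftrightarrow> (\<exists>\<mu>. regular_prob_on LipL0_ball \<mu> \<and> ?dom \<mu> C)" if "0 < C" for C
    by (rule factorable_bound_iff_measure[OF assms(1) that assms(2)])
  have "T \<in> factorable_ops p \<longleftrightarrow> (\<exists>C. 0 < C \<and> (\<exists>\<mu>. regular_prob_on LipL0_ball \<mu> \<and> ?dom \<mu> C))"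
    using assms(2) by (simp add: factorable_ops_def iff cong: conj_cong)
  then show "T \<in> factorable_ops p \<longleftrightarrow> (\<exists>\<mu> C. regular_prob_on LipL0_ball \<mu> \<and> 0 < C \<and> ?dom \<mu> C)"
    by (rule trans) blast
  show "bij_betw linearization (factorable_ops p :: ('x \<times> 'e \<Rightarrow> 'f) set)
        (summing_ops p :: (('x, 'e) proj_tensor \<Rightarrow> 'f) set)"
    by (rule bij_betw_linearization[OF assms(1)])
  fix R :: "'x \<times> 'e \<Rightarrow> 'f" assume R: "R \<in> factorable_ops p"
  then have RL: "R \<in> LipL0" by (simp add: factorable_ops_def)
  show "factorable_norm p R = summing_norm p (linearization R)"
    by (rule factorable_norm_eq_summing_norm[OF assms(1) RL])
  fix S :: "'x \<times> 'e \<Rightarrow> 'f" and a b assume S: "S \<in> factorable_ops p"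
  then have SL: "S \<in> LipL0" by (simp add: factorable_ops_def)
  show "(\<lambda>z. a *\<^sub>R R z + b *\<^sub>R S z) \<in> factorable_ops p"
    by (rule factorable_ops_linear_combination[OF assms(1) R S])
  show "linearization (\<lambda>z. a *\<^sub>R R z + b *\<^sub>R S z)
      = (\<lambda>w. a *\<^sub>R linearization R w + b *\<^sub>R linearization S w)"
    by (rule linearization_linear_combination[OF RL SL])
qed

end
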